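(* For $k=1,\dots,\mathfrak g$, $v_k(x)=O(x^{-2})$ as $x\to\infty$ in every sector $S_j$. For $k=\mathfrak g+1,\dots,d-1$, $v_k(x)=O(x^{-2})$ as $x\to\infty$ in every sector except the sector in which the degenerate cycle $\hat{\mathcal A}_k$ ends, where instead $v_k(x)=\frac{1}{\hbar\,\psi(x)^2}+O(x^{-2})$.
   Context: Fix $\hbar\in\mathbb{C}\setminus\{0\}$, an integer $d\ge 1$ and a polynomial $U$ of degree $2d$. Define the polynomial $V$ (degree $d+1$) by $V'(x)=2\big(\sqrt{U(x)}\big)_+=\sum_{k=0}^{d}t_{k+1}x^k$, where $(\cdot)_+$ is the polynomial part of the Laurent expansion at $x=\infty$; put $P(x)=\frac{V'(x)^2}{4}-U(x)-\frac{\hbar}{2}V''(x)$ (a polynomial of degree $\le d-1$) and $t_0=\lim_{x\to\infty}xP(x)/V'(x)$. With $\theta_0=\arg t_{d+1}$, the Stokes half-lines are $L_k=\{x:\arg x=-\frac{\theta_0}{d+1}+\pi\frac{k+1/2}{d+1}\}$ and the sector $S_k$ ($k=0,\dots,2d+1$, indices mod $2d+2$) is the open sector between $L_{k-1}$ and $L_k$. Let $\psi$ be a nonzero entire solution of $\hbar^2\psi''=U\psi$ which is exponentially decreasing as $x\to\infty$ in $S_0$. In each sector $S_k$, $\psi(x)\sim e^{\eta_k V(x)/(2\hbar)}x^{c_k}(A_k+B_k/x+\dots)$ with $\eta_k\in\{+1,-1\}$ ($\eta_0=-1$). The zeros $s_i$ of $\psi$ are simple and can accumulate only at $\infty$ along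 some half-lines $L_k$. Write $\infty_0$ for $\infty$ in $S_0$. The resolvent is $\omega(x)=\hbar\psi'(x)/\psi(x)+V'(x)/2$. The genus $\mathfrak g$ is defined by $2\mathfrak g+2=$ the number of half-lines $L_k$ along which zeros of $\psi$ accumulate; assume $\mathfrak g\ge0$. The physical sheet is the union of the sectors with $\eta_k=-1$ (there $\omega(x)=t_0/x+O(x^{-2})$); the second sheet is the union of those with $\eta_k=+1$. The $\mathcal A$-cycles $\mathcal A_1,\dots,\mathcal A_{\mathfrak g}$ are homologically independent non-contractible contours avoiding the zeros of $\psi$, each going from $\infty$ in a sector of the physical sheet to $\infty$ in another sector of the physical sheet without going to $\infty$ in second-sheet sectors, each enclosing (on the side not containing $\infty_0$) an even number of half-lines of accumulation of zeros. The degenerate cycles $\hat{\mathcal A}_{\mathfrak g+1},\dots,\hat{\mathcal A}_{d-1}$ are paths from $\infty$ in one sector to $\infty$ in another sector, both sectors being ones in which $\psi$ is exponentially small, chosen so that the $d-1$ paths $\mathcal A_1,\dots,\mathcal A_{\mathfrak g},\hat{\mathcal A}_{\mathfrak g+1},\dots,\hat{\mathcal A}_{d-1}$ are independent. Let $h_1,\dots,h_{d-1}$ be a basis of the polynomials of degree $\le d-2$ and $v_k(x)=\frac{1}{\hbar\psi(x)^2}\int_{\infty_0}^x h_k(x')\psi(x')^2dx'$, the basis being normalized by $\oint_{\mathcal A_\alpha}v_k(x)dx=\delta_{k\alpha}$ for $1\le\alpha\le\mathfrak g$ and $\int_{\hat{\mathcal A}_\alpha}h_k(x)\psi(x)^2dx=\delta_{k\alpha}$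 for $\mathfrak g<\alpha\le d-1$ (these integrals are independent of the position of the paths relative to the $s_i$ since $1/\psi^2$ has zero residues there).
   Formalization: The degenerate cycles are all taken to start at infinity in S_0 and to end in pairwise distinct other exponentially small sectors; for cycles between arbitrary small sectors (reversed or chained) the stated asymptotics fail. *)

theory Defs
  imports "HOL-Analysis.Analysis" "HOL-Library.Landau_Symbols"
begin

text \<open>Angle of the Stokes half-line L_j (j taken mod 2d+2), where V' = pderiv V,
  t_(d+1) = lead_coeff (pderiv V), theta_0 = Arg t_(d+1).\<close>
definition stokes_angle :: "complex poly \<Rightarrow> nat \<Rightarrow> nat \<Rightarrow> real" where
  "stokes_angle V d j =
     - Arg (lead_coeff (pderiv V)) / real (d + 1) + pi * (real j + 1/2) / real (d + 1)"

text \<open>The sector S_j is the open sector between L_(j-1) and L_j, i.e. the arguments in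
  (stokes_angle j - pi/(d+1), stokes_angle j).  Its closed subsectors (shrunk by delta):\<close>
definition closed_subsector :: "complex poly \<Rightarrow> nat \<Rightarrow> nat \<Rightarrow> real \<Rightarrow> complex set" where
  "closed_subsector V d j \<delta> =
     {x. \<exists>r \<phi>. r > 0 \<and> stokes_angle V d j - pi / real (d + 1) + \<delta> \<le> \<phi>
              \<and> \<phi> \<le> stokes_angle V d j - \<delta> \<and> x = of_real r * cis \<phi>}"

definition sector_filter :: "complex poly \<Rightarrow> nat \<Rightarrow> nat \<Rightarrow> real \<Rightarrow> complex filter" where
  "sector_filter V d j \<delta> = inf at_infinity (principal (closed_subsector V d j \<delta>))"

definition sector_bigo :: "complex poly \<Rightarrow> nat \<Rightarrow> nat \<Rightarrow> (complex \<Rightarrow> complex) \<Rightarrow> (complex \<Rightarrow> complex) \<Rightarrow> bool" where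
  "sector_bigo V d j f g \<longleftrightarrow> (\<forall>\<delta>>0. f \<in> O[sector_filter V d j \<delta>](g))"

definition exp_small :: "complex poly \<Rightarrow> nat \<Rightarrow> (complex \<Rightarrow> complex) \<Rightarrow> nat \<Rightarrow> bool" where
  "exp_small V d \<psi> j \<longleftrightarrow>
     (\<forall>\<delta>>0. \<exists>c>0. eventually (\<lambda>x. norm (\<psi> x) \<le> exp (- c * norm x)) (sector_filter V d j \<delta>))"

text \<open>eta_j = -1, i.e. psi(x) ~ exp(-V(x)/(2 hbar)) x^(c_j) (A_j + ...) with A_j \<noteq> 0 in S_j:
  psi(x) exp(V(x)/(2 hbar)) is bounded above and below by powers of x (sector of the physical sheet).\<close>
definition physical :: "complex poly \<Rightarrow> nat \<Rightarrow> complex \<Rightarrow> (complex \<Rightarrow> complex) \<Rightarrow> nat \<Rightarrow> bool" where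
  "physical V d \<h> \<psi> j \<longleftrightarrow>
     (\<forall>\<delta>>0. \<exists>N::nat.
        (\<lambda>x. \<psi> x * exp (poly V x / (2 * \<h>))) \<in> O[sector_filter V d j \<delta>](\<lambda>x. x ^ N) \<and>
        (\<lambda>x. 1 / (\<psi> x * exp (poly V x / (2 * \<h>)))) \<in> O[sector_filter V d j \<delta>](\<lambda>x. x ^ N))"

definition accumulates :: "complex poly \<Rightarrow> nat \<Rightarrow> (complex \<Rightarrow> complex) \<Rightarrow> nat \<Rightarrow> bool" where
  "accumulates V d \<psi> j \<longleftrightarrow>
     (\<forall>\<epsilon>>0. infinite {s. \<psi> s = 0 \<and>
        (\<exists>r \<phi>. r > 0 \<and> \<bar>\<phi> - stokes_angle V d j\<bar> < \<epsilon> \<and> s = of_real r * cis \<phi>)})"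

definition ends_in :: "complex poly \<Rightarrow> nat \<Rightarrow> nat \<Rightarrow> (real \<Rightarrow> complex) \<Rightarrow> real filter \<Rightarrow> bool" where
  "ends_in V d j \<gamma> F \<longleftrightarrow>
     filterlim (\<lambda>t. norm (\<gamma> t)) at_top F \<and>
     (\<exists>\<delta>>0. eventually (\<lambda>t. \<gamma> t \<in> closed_subsector V d j \<delta>) F)"

definition path_integral_is :: "(real \<Rightarrow> complex) \<Rightarrow> (complex \<Rightarrow> complex) \<Rightarrow> complex \<Rightarrow> bool" where
  "path_integral_is \<gamma> f c \<longleftrightarrow>
     ((\<lambda>t. f (\<gamma> t) * vector_derivative \<gamma> (at t)) has_integral c) UNIV"

text \<open>Integral of an entire function f from \<infinity>_0 to x: along the bisecting ray of S_0
  (argument -theta_0/(d+1)) from \<infinity> to 0, then along the segment from 0 to x.\<close>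
definition int_from_inf0 :: "complex poly \<Rightarrow> nat \<Rightarrow> (complex \<Rightarrow> complex) \<Rightarrow> complex \<Rightarrow> complex" where
  "int_from_inf0 V d f x =
     (let \<phi>0 = - Arg (lead_coeff (pderiv V)) / real (d + 1) in
       - integral {0..} (\<lambda>r::real. f (of_real r * cis \<phi>0) * cis \<phi>0)
       + integral {0..1} (\<lambda>t::real. f (of_real t * x) * x))"

definition vfun :: "complex poly \<Rightarrow> nat \<Rightarrow> complex \<Rightarrow> (complex \<Rightarrow> complex) \<Rightarrow> complex poly \<Rightarrow> complex \<Rightarrow> complex" where
  "vfun V d \<h> \<psi> hk x = int_from_inf0 V d (\<lambda>y. poly hk y * \<psi> y ^ 2) x / (\<h> * \<psi> x ^ 2)"

end

theory Submission
  imports Defs "HOL-Complex_Analysis.Complex_Analysis"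
begin

text \<open>
  The degenerate cycles alone decide the asymptotics. Decay of \<open>\<psi> \<sim> exp (- V / (2\<h>))\<close> in all of
  \<open>S\<^sub>0\<close> forces \<open>\<h> > 0\<close>. Put
  \<open>W = \<plusminus>V / (2\<h>)\<close>, the sign making \<open>Re W\<close> positive in a given sector. Where \<open>W\<close> grows, the Riccati flow of
  \<open>\<psi>'/\<psi>\<close> attracts everything to \<open>W'\<close> except a solution staying near \<open>-W'\<close> throughout, so in each sector
  \<open>\<psi>\<close> is either small or large. When it is large, \<open>\<integral> h\<^sub>k \<psi>\<^sup>2\<close> is automatically \<open>O(\<psi>\<^sup>2 / x\<^sup>2)\<close>;
  when it is small, the same bound holds after subtracting the limit of the integral in that sector.
  A small sector has no zeros of \<open>\<psi>\<close> near its two boundary half-lines, and adjacent sectors are not both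
  small, so by the definition of the genus there are at most \<open>d - g\<close> small sectors: these are \<open>S\<^sub>0\<close> and the
  end sectors of the \<open>d - 1 - g\<close> degenerate cycles, where the limits are prescribed by the
  normalization.
\<close>

section \<open>Growth along forward rays\<close>

text \<open>No asymptotic expansion of \<psi> is taken as input, and \<psi>'/\<psi> may have poles,
  so the Riccati flow is never integrated directly. It is replaced by a linear system for \<psi>' +
  W'\<psi> and \<psi>' - W'\<psi>, regular at the zeros of \<psi>, and by quadratic forms |A|^2 -
  k^2 |B|^2 that increase along straight segments in a coordinate z behaving like W. The same forms
  show that a small solution stays small beyond its sector: a horizontal ray with large |Im z|
  eventually enters the half plane Re z > 0, and a zero of \<psi> would force A = B. Positivity of
  \<h> comes before the sector analysis because the half-lines L_j are defined by arg t_(d+1) alone;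
  they separate growth from decay of exp (V / \<h>) with the expected signs only for \<h> > 0. The
  comparison function is (\<psi>/x)^2 and not \<psi>^2, since deg h + 2 is at most deg W'; this is
  where the order x^-2 originates.\<close>

lemma ray_vector_derivative:
  fixes f :: "complex \<Rightarrow> complex"
  assumes "(f has_field_derivative f') (at (z + of_real t * e))"
  shows "((\<lambda>t. f (z + of_real t * e)) has_vector_derivative (e * f')) (at t)"
proof -
  have "((\<lambda>t. z + of_real t * e) has_vector_derivative e) (at t)"
    by (auto intro!: derivative_eq_intros)
  from field_vector_diff_chain_at[OF this assms] show ?thesis
    by (simp add: o_def)
qed

lemma norm_square_ray_derivative:
  fixes f :: "complex \<Rightarrow> complex"
  assumes "(f has_field_derivative f') (at (z + of_real t * e))"
  shows "((\<lambda>t. (cmod (f (z + of_real t * e)))\<^sup>2) has_real_derivative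
           2 * (f (z + of_real t * e) \<bullet> (e * f'))) (at t)"
proof -
  have "((\<lambda>t. f (z + of_real t * e)) has_derivative (\<lambda>s. s *\<^sub>R (e * f'))) (at t)"
    using ray_vector_derivative[OF assms] by (simp add: has_vector_derivative_def)
  from has_derivative_inner[OF this this] show ?thesis
    unfolding has_field_derivative_def power2_norm_eq_inner
    by (rule has_derivative_eq_rhs) (auto simp: inner_commute algebra_simps)
qed

lemma inner_mult_self_complex: "(A::complex) \<bullet> (u * A) = Re u * (cmod A)\<^sup>2"
  unfolding cmod_power2 by (simp add: inner_complex_def algebra_simps power2_eq_square)

text \<open>A expands and B contracts at a rate of at least c - \<eta>, and B enters with a minus
  sign, so the diagonal part gives 2 (c - \<eta>) (|A|^2 + \<kappa>^2 |B|^2). The coupling through A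
  - B costs 2 \<eta> times this form plus 2 \<eta> (1 + \<kappa>^2) |A| |B|, and the
  arithmetic-geometric mean inequality converts the mixed term with the factor \<kappa> +
  1/\<kappa>. Hence 4 + \<kappa> + 1/\<kappa>: half of the growth 2 c pays for all errors.\<close>

lemma cone_derivative_bound:
  fixes A B w a b e :: complex and \<kappa> c \<eta> :: real
  assumes e: "cmod e = 1" "Re e \<ge> c" and k: "\<kappa> > 0"
    and w: "cmod (w - 1) \<le> \<eta>" and a: "cmod a \<le> \<eta>" and b: "cmod b \<le> \<eta>"
    and eta: "\<eta> * (4 + \<kappa> + 1 / \<kappa>) \<le> c"
  shows "2 * (A \<bullet> (e * (w * A + a * (A - B))))
           - \<kappa>\<^sup>2 * (2 * (B \<bullet> (e * (- w * B + b * (A - B)))))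
         \<ge> c * ((cmod A)\<^sup>2 + \<kappa>\<^sup>2 * (cmod B)\<^sup>2)"
proof -
  define X Y where "X = cmod A" and "Y = cmod B"
  have \<eta>0: "\<eta> \<ge> 0" using a norm_ge_zero order_trans by blast
  have Rew: "Re (e * w) \<ge> c - \<eta>"
  proof -
    have "\<bar>Re (e * (w - 1))\<bar> \<le> \<eta>"
      using abs_Re_le_cmod[of "e * (w - 1)"] w e by (simp add: norm_mult)
    then show ?thesis using e by (simp add: algebra_simps)
  qed
  have tri: "cmod (A - B) \<le> X + Y" unfolding X_def Y_def by (rule norm_triangle_ineq4)
  have bd: "\<bar>C \<bullet> (e * (s * (A - B)))\<bar> \<le> cmod C * (\<eta> * (X + Y))" if "cmod s \<le> \<eta>" for C s
  proof -
    have "\<bar>C \<bullet> (e * (s * (A - B)))\<bar> \<le> cmod C * cmod (e * (s * (A - B)))"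
      by (rule Cauchy_Schwarz_ineq2)
    also have "\<dots> \<le> cmod C * (\<eta> * (X + Y))"
      using e that tri \<eta>0 by (auto simp: norm_mult intro!: mult_left_mono mult_mono)
    finally show ?thesis .
  qed
  have 1: "A \<bullet> (e * (w * A + a * (A - B))) \<ge> (c - \<eta>) * X\<^sup>2 - X * (\<eta> * (X + Y))"
  proof -
    have "A \<bullet> (e * (w * A + a * (A - B))) = Re (e * w) * X\<^sup>2 + A \<bullet> (e * (a * (A - B)))"
      unfolding X_def inner_mult_self_complex[symmetric] inner_add_right[symmetric]
      by (simp add: algebra_simps)
    moreover have "Re (e * w) * X\<^sup>2 \<ge> (c - \<eta>) * X\<^sup>2" using Rew by (intro mult_right_mono) auto
    moreover have "\<bar>A \<bullet> (e * (a * (A - B)))\<bar> \<le> X * (\<eta> * (X + Y))"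
      using bd[OF a, of A] by (simp add: X_def)
    ultimately show ?thesis by linarith
  qed
  have 2: "B \<bullet> (e * (- w * B + b * (A - B))) \<le> - ((c - \<eta>) * Y\<^sup>2) + Y * (\<eta> * (X + Y))"
  proof -
    have "B \<bullet> (e * (- w * B + b * (A - B))) = - (Re (e * w) * Y\<^sup>2) + B \<bullet> (e * (b * (A - B)))"
      unfolding Y_def inner_mult_self_complex[symmetric] inner_add_right[symmetric]
        inner_minus_right[symmetric]
      by (simp add: algebra_simps)
    moreover have "Re (e * w) * Y\<^sup>2 \<ge> (c - \<eta>) * Y\<^sup>2" using Rew by (intro mult_right_mono) auto
    moreover have "\<bar>B \<bullet> (e * (b * (A - B)))\<bar> \<le> Y * (\<eta> * (X + Y))"
      using bd[OF b, of B] by (simp add: Y_def)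
    ultimately show ?thesis by linarith
  qed
  have XY: "X * Y * (2 * \<kappa>) \<le> X\<^sup>2 + \<kappa>\<^sup>2 * Y\<^sup>2"
    using zero_le_power2[of "X - \<kappa> * Y"] by (simp add: power2_eq_square algebra_simps)
  have 3: "(1 + \<kappa>\<^sup>2) * (X * Y) * 2 \<le> (\<kappa> + 1 / \<kappa>) * (X\<^sup>2 + \<kappa>\<^sup>2 * Y\<^sup>2)"
  proof -
    have "(\<kappa> + 1 / \<kappa>) * (X * Y * (2 * \<kappa>)) \<le> (\<kappa> + 1 / \<kappa>) * (X\<^sup>2 + \<kappa>\<^sup>2 * Y\<^sup>2)"
      using XY k by (intro mult_left_mono) auto
    moreover have "(\<kappa> + 1 / \<kappa>) * (X * Y * (2 * \<kappa>)) = (1 + \<kappa>\<^sup>2) * (X * Y) * 2"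
      using k by (simp add: field_simps power2_eq_square)
    ultimately show ?thesis by simp
  qed
  have 4: "\<eta> * (4 + \<kappa> + 1 / \<kappa>) * (X\<^sup>2 + \<kappa>\<^sup>2 * Y\<^sup>2) \<le> c * (X\<^sup>2 + \<kappa>\<^sup>2 * Y\<^sup>2)"
    using eta by (intro mult_right_mono) auto
  have 5: "\<eta> * ((1 + \<kappa>\<^sup>2) * (X * Y) * 2) \<le> \<eta> * ((\<kappa> + 1 / \<kappa>) * (X\<^sup>2 + \<kappa>\<^sup>2 * Y\<^sup>2))"
    using 3 \<eta>0 by (rule mult_left_mono)
  have 6: "\<kappa>\<^sup>2 * (2 * (B \<bullet> (e * (- w * B + b * (A - B)))))
      \<le> \<kappa>\<^sup>2 * (2 * (- ((c - \<eta>) * Y\<^sup>2) + Y * (\<eta> * (X + Y))))"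
    using 2 by (intro mult_left_mono) auto
  define S where "S = X\<^sup>2 + \<kappa>\<^sup>2 * Y\<^sup>2"
  define K where "K = \<kappa> + 1 / \<kappa>"
  define IA where "IA = A \<bullet> (e * (w * A + a * (A - B)))"
  define IB where "IB = B \<bullet> (e * (- w * B + b * (A - B)))"
  have 7: "4 * (\<eta> * S) + \<eta> * (K * S) \<le> c * S"
    using 4 unfolding S_def[symmetric] K_def by (simp add: algebra_simps)
  have "2 * ((c - \<eta>) * X\<^sup>2 - X * (\<eta> * (X + Y))) - \<kappa>\<^sup>2 * (2 * (- ((c - \<eta>) * Y\<^sup>2) + Y * (\<eta> * (X + Y))))
      = 2 * (c * S) - 4 * (\<eta> * S) - \<eta> * ((1 + \<kappa>\<^sup>2) * (X * Y) * 2)"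
    unfolding S_def by (simp add: algebra_simps power2_eq_square)
  moreover have "\<eta> * ((1 + \<kappa>\<^sup>2) * (X * Y) * 2) \<le> \<eta> * (K * S)"
    using 5 unfolding S_def K_def .
  moreover have "cs \<le> 2 * i - k" if "2 * u - v = 2 * cs - 4 * es - x" "x \<le> y"
      "u \<le> i" "k \<le> v" "4 * es + y \<le> cs" for u v cs es x y i k :: real
    using that by linarith
  ultimately have "c * S \<le> 2 * IA - \<kappa>\<^sup>2 * (2 * IB)"
    using 1[folded IA_def] 6[folded IB_def] 7 by blast
  then show ?thesis unfolding S_def IA_def IB_def X_def Y_def .
qed

text \<open>The quantities \<open>|A|\<^sup>2 - k\<^sup>2 |B|\<^sup>2\<close> increase along forward rays, so \<open>|A| > k |B|\<close>,
  once it holds, is amplified until \<open>|A| > k' |B|\<close>.\<close>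

lemma cone_growth:
  fixes A B w a b :: "complex \<Rightarrow> complex" and z e :: complex and k k' c \<eta> s :: real
  assumes e: "cmod e = 1" "Re e \<ge> c" and c: "c > 0" and k: "k > 0" "k' > 0"
    and der: "\<And>t. 0 \<le> t \<Longrightarrow> t \<le> s \<Longrightarrow> (let y = z + of_real t * e in
        (A has_field_derivative (w y * A y + a y * (A y - B y))) (at y) \<and>
        (B has_field_derivative (- w y * B y + b y * (A y - B y))) (at y) \<and>
        cmod (w y - 1) \<le> \<eta> \<and> cmod (a y) \<le> \<eta> \<and> cmod (b y) \<le> \<eta>)"
    and eta: "\<eta> * (4 + k + 1 / k) \<le> c" "\<eta> * (4 + k' + 1 / k') \<le> c"
    and s: "s \<ge> 0"
    and pos: "cmod (A z) > k * cmod (B z)"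
  shows "(cmod (A (z + of_real s * e)))\<^sup>2 - k'\<^sup>2 * (cmod (B (z + of_real s * e)))\<^sup>2
    \<ge> (cmod (A z))\<^sup>2 - k'\<^sup>2 * (cmod (B z))\<^sup>2 + c * s * ((cmod (A z))\<^sup>2 - k\<^sup>2 * (cmod (B z))\<^sup>2)"
proof -
  define F where "F = (\<lambda>\<kappa> t. (cmod (A (z + of_real t * e)))\<^sup>2 - \<kappa>\<^sup>2 * (cmod (B (z + of_real t * e)))\<^sup>2)"
  have D: "\<exists>D. (F \<kappa> has_real_derivative D) (at t) \<and>
      D \<ge> c * ((cmod (A (z + of_real t * e)))\<^sup>2 + \<kappa>\<^sup>2 * (cmod (B (z + of_real t * e)))\<^sup>2)"
    if t: "0 \<le> t" "t \<le> s" and \<kappa>: "\<kappa> > 0" "\<eta> * (4 + \<kappa> + 1 / \<kappa>) \<le> c" for t \<kappa>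
  proof -
    note d = der[OF t, unfolded Let_def]
    let ?y = "z + of_real t * e"
    have "(F \<kappa> has_real_derivative (2 * (A ?y \<bullet> (e * (w ?y * A ?y + a ?y * (A ?y - B ?y))))
           - \<kappa>\<^sup>2 * (2 * (B ?y \<bullet> (e * (- w ?y * B ?y + b ?y * (A ?y - B ?y))))))) (at t)"
      unfolding F_def
      by (intro DERIV_diff DERIV_cmult norm_square_ray_derivative) (use d in auto)
    moreover have "2 * (A ?y \<bullet> (e * (w ?y * A ?y + a ?y * (A ?y - B ?y))))
           - \<kappa>\<^sup>2 * (2 * (B ?y \<bullet> (e * (- w ?y * B ?y + b ?y * (A ?y - B ?y))))) \<ge> 
         c * ((cmod (A ?y))\<^sup>2 + \<kappa>\<^sup>2 * (cmod (B ?y))\<^sup>2)"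
      using d e \<kappa> by (intro cone_derivative_bound[where \<eta>=\<eta>]) auto
    ultimately show ?thesis by blast
  qed
  have mono: "F k 0 \<le> F k t" if "0 \<le> t" "t \<le> s" for t
  proof (rule DERIV_nonneg_imp_nondecreasing[OF that(1)])
    fix x assume "0 \<le> x" "x \<le> t"
    with that D[of x k] k eta obtain D' where "(F k has_real_derivative D') (at x)"
      "D' \<ge> c * ((cmod (A (z + of_real x * e)))\<^sup>2 + k\<^sup>2 * (cmod (B (z + of_real x * e)))\<^sup>2)" by auto
    moreover have "c * ((cmod (A (z + of_real x * e)))\<^sup>2 + k\<^sup>2 * (cmod (B (z + of_real x * e)))\<^sup>2) \<ge> 0"
      using c by auto
    ultimately show "\<exists>y. (F k has_real_derivative y) (at x) \<and> 0 \<le> y" by (meson order_trans)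
  qed
  \<comment> \<open>The derivative of F k' is at least c (|A|^2 + k'^2 |B|^2), which dominates c * F
    k and therefore c * F k 0; so F k' outgrows the line of slope c * F k 0.\<close>
  have "F k' 0 - c * 0 * F k 0 \<le> F k' s - c * s * F k 0"
  proof (rule DERIV_nonneg_imp_nondecreasing[OF s, where f="\<lambda>t. F k' t - c * t * F k 0"])
    fix x assume x: "0 \<le> x" "x \<le> s"
    with D[of x k'] k eta obtain D' where D': "(F k' has_real_derivative D') (at x)"
      "D' \<ge> c * ((cmod (A (z + of_real x * e)))\<^sup>2 + k'\<^sup>2 * (cmod (B (z + of_real x * e)))\<^sup>2)" by auto
    have "F k 0 \<le> F k x" using mono x by auto
    also have "\<dots> \<le> (cmod (A (z + of_real x * e)))\<^sup>2 + k'\<^sup>2 * (cmod (B (z + of_real x * e)))\<^sup>2"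
      unfolding F_def by (smt (verit) mult_nonneg_nonneg zero_le_power2)
    finally have "D' - c * F k 0 \<ge> 0" using D'(2) c by (smt (verit) mult_left_mono)
    moreover have "((\<lambda>t. F k' t - c * t * F k 0) has_real_derivative (D' - c * F k 0)) (at x)"
      using D'(1) by (auto intro!: derivative_eq_intros)
    ultimately show "\<exists>y. ((\<lambda>t. F k' t - c * t * F k 0) has_real_derivative y) (at x) \<and> 0 \<le> y"
      by blast
  qed
  then show ?thesis by (simp add: F_def)
qed

text \<open>The derivative of |E| is at least c |E|, so a function whose derivative is bounded by C
  |E| varies by at most C/c times the increase of |E|. The integral is thus controlled by the
  integrand at the far end, with no factor for the length of the segment.\<close>

lemma segment_growth:
  fixes E \<Phi> lam \<Phi>' :: "complex \<Rightarrow> complex" and z e :: complex and c C s :: real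
  assumes s: "s \<ge> 0" and c: "c > 0" and C: "C \<ge> 0"
    and E: "\<And>t. 0 \<le> t \<Longrightarrow> t \<le> s \<Longrightarrow> (let y = z + of_real t * e in
        (E has_field_derivative (lam y * E y)) (at y) \<and> E y \<noteq> 0 \<and> Re (e * lam y) \<ge> c \<and>
        (\<Phi> has_field_derivative \<Phi>' y) (at y) \<and> cmod (e * \<Phi>' y) \<le> C * cmod (E y))"
  shows "cmod (E (z + of_real s * e)) \<ge> exp (c * s) * cmod (E z)"
    and "cmod (\<Phi> (z + of_real s * e) - \<Phi> z) \<le> C / c * cmod (E (z + of_real s * e))"
proof -
  define N where "N = (\<lambda>t. cmod (E (z + of_real t * e)))"
  define l where "l = (\<lambda>t::real. Re (e * lam (z + of_real t * e)))"
  have N: "(N has_real_derivative (l t * N t)) (at t)" "l t \<ge> c" "N t > 0"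
    if t: "0 \<le> t" "t \<le> s" for t
  proof -
    note d = E[OF t, unfolded Let_def]
    let ?y = "z + of_real t * e"
    have "((\<lambda>t. E (z + of_real t * e)) has_derivative (\<lambda>x. x *\<^sub>R (e * (lam ?y * E ?y)))) (at t)"
      using ray_vector_derivative[of E "lam ?y * E ?y" z t e] d by (simp add: has_vector_derivative_def)
    from has_derivative_compose[OF this has_derivative_norm] d
    have "(N has_derivative (\<lambda>x. inner (sgn (E ?y)) (x *\<^sub>R (e * (lam ?y * E ?y))))) (at t)"
      by (simp add: N_def inner_commute)
    moreover have "inner (sgn (E ?y)) (e * (lam ?y * E ?y)) = l t * N t"
    proof -
      have "inner (sgn (E ?y)) (e * (lam ?y * E ?y)) = inner (E ?y) ((e * lam ?y) * E ?y) / cmod (E ?y)"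
        by (simp add: sgn_div_norm divide_inverse mult.commute mult.left_commute)
      also have "\<dots> = l t * N t"
        unfolding inner_mult_self_complex by (simp add: l_def N_def power2_eq_square)
      finally show ?thesis .
    qed
    ultimately show "(N has_real_derivative (l t * N t)) (at t)"
      unfolding has_field_derivative_def
      by (elim has_derivative_eq_rhs) (simp add: fun_eq_iff mult.commute)
    show "l t \<ge> c" "N t > 0" using d by (auto simp: l_def N_def)
  qed
  have "exp (- (c * 0)) * N 0 \<le> exp (- (c * s)) * N s"
  proof (rule DERIV_nonneg_imp_nondecreasing[OF s, where f="\<lambda>t. exp (- (c * t)) * N t"])
    fix x assume x: "0 \<le> x" "x \<le> s"
    have "((\<lambda>t. exp (- (c * t)) * N t) has_real_derivative (exp (- (c * x)) * ((l x - c) * N x))) (at x)"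
      using N(1)[OF x] by (auto intro!: derivative_eq_intros simp: algebra_simps)
    moreover have "exp (- (c * x)) * ((l x - c) * N x) \<ge> 0"
      using N(2,3)[OF x] by simp
    ultimately show "\<exists>y. ((\<lambda>t. exp (- (c * t)) * N t) has_real_derivative y) (at x) \<and> 0 \<le> y" by blast
  qed
  then show "cmod (E (z + of_real s * e)) \<ge> exp (c * s) * cmod (E z)"
    by (simp add: N_def exp_minus field_simps)
  show "cmod (\<Phi> (z + of_real s * e) - \<Phi> z) \<le> C / c * cmod (E (z + of_real s * e))"
  proof (cases "s = 0")
    case True then show ?thesis using C c by simp
  next
    case False
    then have s0: "0 < s" using s by simp
    have "norm ((\<lambda>t. \<Phi> (z + of_real t * e)) s - (\<lambda>t. \<Phi> (z + of_real t * e)) 0)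
            \<le> (\<lambda>t. C / c * N t) s - (\<lambda>t. C / c * N t) 0"
    proof (rule differentiable_bound_general[OF s0,
          where f'="\<lambda>t. e * \<Phi>' (z + of_real t * e)" and \<phi>'="\<lambda>t. C / c * (l t * N t)"])
      show "continuous_on {0..s} (\<lambda>t. C / c * N t)"
        by (intro continuous_intros DERIV_continuous_on) (auto intro: N(1) DERIV_subset)
      show "continuous_on {0..s} (\<lambda>t. \<Phi> (z + of_real t * e))"
        by (rule continuous_on_vector_derivative[where f'="\<lambda>t. e * \<Phi>' (z + of_real t * e)"])
          (use E in \<open>auto simp: Let_def intro!: has_vector_derivative_at_within ray_vector_derivative\<close>)
      fix x assume x: "0 < x" "x < s"
      then have x': "0 \<le> x" "x \<le> s" by auto
      show "((\<lambda>t. \<Phi> (z + of_real t * e)) has_vector_derivative e * \<Phi>' (z + of_real x * e)) (at x)"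
        using E[OF x'] by (auto simp: Let_def intro!: ray_vector_derivative)
      show "((\<lambda>t. C / c * N t) has_vector_derivative C / c * (l x * N x)) (at x)"
        using DERIV_cmult[OF N(1)[OF x'], of "C / c"]
        by (simp add: has_real_derivative_iff_has_vector_derivative)
      have "norm (e * \<Phi>' (z + of_real x * e)) \<le> C * N x"
        using E[OF x'] by (auto simp: Let_def N_def)
      also have "\<dots> = C / c * (c * N x)" using c by simp
      also have "\<dots> \<le> C / c * (l x * N x)"
        using N(2,3)[OF x'] C c by (intro mult_left_mono mult_right_mono) auto
      finally show "norm (e * \<Phi>' (z + of_real x * e)) \<le> C / c * (l x * N x)" .
    qed
    also have "\<dots> \<le> C / c * N s" using C c N(3)[of 0] s by simp
    finally show ?thesis by (simp add: N_def)
  qed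
qed

section \<open>Dichotomy in a Stokes sector\<close>

text \<open>By the Leibniz rule the equation expresses each derivative of order l + 2 at
  \<open>a\<close> through lower ones, so the whole Taylor series at \<open>a\<close>
  vanishes.\<close>

lemma linear_ode_unique_zero:
  fixes \<psi> Q :: "complex \<Rightarrow> complex"
  assumes hol: "\<psi> holomorphic_on UNIV" "Q holomorphic_on UNIV"
    and ode: "\<And>x. deriv (deriv \<psi>) x = Q x * \<psi> x"
    and zero: "\<psi> a = 0" "deriv \<psi> a = 0"
  shows "\<psi> x = 0"
proof -
  have D: "(deriv ^^ k) \<psi> a = 0" for k
  proof (induction k rule: less_induct)
    case (less k)
    consider "k = 0" | "k = 1" | l where "k = Suc (Suc l)" by (metis One_nat_def not0_implies_Suc)
    then show ?case
    proof cases
      case 3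
      have "(deriv ^^ k) \<psi> a = (deriv ^^ l) (deriv (deriv \<psi>)) a"
        by (simp add: 3 funpow_swap1)
      also have "deriv (deriv \<psi>) = (\<lambda>x. Q x * \<psi> x)" using ode by auto
      also have "(deriv ^^ l) (\<lambda>x. Q x * \<psi> x) a
          = (\<Sum>i = 0..l. of_nat (l choose i) * (deriv ^^ i) Q a * (deriv ^^ (l - i)) \<psi> a)"
        using hol by (intro higher_deriv_mult) auto
      also have "\<dots> = 0"
        using less.IH by (intro sum.neutral) (auto simp: 3)
      finally show ?thesis .
    qed (use zero in auto)
  qed
  show ?thesis
    by (rule holomorphic_fun_eq_0_on_connected[OF hol(1) _ _ D]) auto
qed

text \<open>Seen from a fixed base point z1, a distant point of the cone lies in a direction that
  keeps half of the aperture. Since Re (z - z1) is at least c |z| - |z1|, the threshold 1 + 2/c is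
  exactly what c/2 (|z| + |z1|) demands.\<close>

lemma unit_direction:
  fixes z z1 :: complex
  assumes "0 < c" "c \<le> 1" and z: "Re z \<ge> c * cmod z" "cmod z > (1 + 2 / c) * cmod z1"
  obtains e where "cmod e = 1" "Re e \<ge> c / 2" "z = z1 + of_real (cmod (z - z1)) * e"
proof -
  have "cmod z > cmod z1 + 2 / c * cmod z1" using z(2) by (simp add: algebra_simps)
  moreover have "2 / c * cmod z1 \<ge> 0" using assms by auto
  ultimately have ne: "z \<noteq> z1" by auto
  have "c / 2 * cmod (z - z1) \<le> Re (z - z1)"
  proof -
    have "c * cmod z > c * ((1 + 2 / c) * cmod z1)" using z(2) assms by simp
    then have "c * cmod z > c * cmod z1 + 2 * cmod z1" using assms by (simp add: algebra_simps)
    moreover have "c / 2 * cmod (z - z1) \<le> c / 2 * (cmod z + cmod z1)"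
      using assms norm_triangle_ineq4[of z z1] by (intro mult_left_mono) auto
    moreover have "Re z1 \<le> cmod z1" by (rule complex_Re_le_cmod)
    moreover have "cmod z1 \<ge> 0" by simp
    ultimately show ?thesis using z(1) by (simp add: algebra_simps)
  qed
  with ne have "cmod ((z - z1) / of_real (cmod (z - z1))) = 1"
      "Re ((z - z1) / of_real (cmod (z - z1))) \<ge> c / 2"
      "z = z1 + of_real (cmod (z - z1)) * ((z - z1) / of_real (cmod (z - z1)))"
    by (auto simp: norm_divide field_simps)
  then show thesis using that by blast
qed

text \<open>For A, B = \<psi>' + W'\<psi>, \<psi>' - W'\<psi> the quotient is \<psi>'/(W'\<psi>).
  The ratio c/20 keeps |A - B| above 19/20 |A|, whence 2 c / 19.\<close>

lemma mobius_near_one: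
  fixes A B :: complex
  assumes "cmod B \<le> c / 20 * cmod A" "0 < c" "c \<le> 1" "A \<noteq> 0"
  shows "cmod ((A + B) / (A - B) - 1) \<le> 2 * c / 19" "A \<noteq> B"
proof -
  have A0: "cmod A > 0" using assms by simp
  have "c / 20 * cmod A \<le> 1 / 20 * cmod A" using assms by (intro mult_right_mono) auto
  then have "cmod B \<le> 1 / 20 * cmod A" using assms(1) by simp
  then have d: "cmod (A - B) \<ge> 19 / 20 * cmod A" using norm_triangle_ineq2[of A B] by simp
  then show ne: "A \<noteq> B" using A0 by auto
  have "(A + B) / (A - B) - 1 = 2 * B / (A - B)" using ne by (simp add: field_simps)
  then have "cmod ((A + B) / (A - B) - 1) = 2 * cmod B / cmod (A - B)"
    by (simp add: norm_divide norm_mult)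
  also have "\<dots> \<le> 2 * (c / 20 * cmod A) / (19 / 20 * cmod A)"
    using assms d A0 by (intro frac_le) auto
  also have "\<dots> = 2 * c / 19" using A0 by simp
  finally show "cmod ((A + B) / (A - B) - 1) \<le> 2 * c / 19" .
qed

lemma rate_estimate:
  fixes w q u :: complex
  assumes c: "0 < c" "c \<le> 1" and "cmod (w - 1) \<le> c / 20" "cmod (q - 1) \<le> 2 * c / 19" "cmod u \<le> c / 20"
  shows "cmod (2 * (w * q - u) - 2) \<le> c"
proof -
  have "cmod q \<le> cmod (q - 1) + cmod 1" using norm_triangle_ineq[of "q - 1" 1] by simp
  then have q: "cmod q \<le> 21 / 19" using assms by simp
  have "2 * (w * q - u) - 2 = 2 * ((w - 1) * q + (q - 1) - u)" by (simp add: algebra_simps)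
  then have "cmod (2 * (w * q - u) - 2) = 2 * cmod ((w - 1) * q + (q - 1) - u)"
    by (simp only: norm_mult norm_numeral)
  also have "\<dots> \<le> 2 * (cmod ((w - 1) * q) + cmod (q - 1) + cmod u)"
    by (smt (verit) norm_triangle_ineq norm_triangle_ineq4)
  also have "cmod ((w - 1) * q) \<le> c / 20 * (21 / 19)"
    unfolding norm_mult using q assms by (intro mult_mono) auto
  finally show ?thesis using assms by simp
qed

text \<open>A sector is uniformised by \<open>W(X z) \<sim> z\<close>; its open half plane \<open>Re z > 0\<close> is the Stokes
  sector, where \<open>e\<^sup>W\<close> grows. With \<open>A = \<psi>' + W'\<psi>\<close> and \<open>B = \<psi>' - W'\<psi>\<close> the equation becomes
  \<open>A' = w A + a (A - B)\<close>, \<open>B' = - w B + b (A - B)\<close> in the variable \<open>z\<close>, with \<open>w \<rightarrow> 1\<close> and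
  \<open>a, b \<rightarrow> 0\<close> at infinity.\<close>

locale stokes_sector =
  fixes W r :: "complex poly" and n :: nat and m :: real and \<rho> :: complex
    and \<psi> :: "complex \<Rightarrow> complex"
  assumes n2: "2 \<le> n" and deg_W: "degree W = n" and deg_r: "degree r < 2 * (n - 1)"
    and hol: "\<psi> holomorphic_on UNIV"
    and ode: "\<And>x. deriv (deriv \<psi>) x = poly ((pderiv W)\<^sup>2 - r) x * \<psi> x"
    and nz: "\<exists>x. \<psi> x \<noteq> 0"
    and norm_rho: "cmod \<rho> = 1" and m_pos: "m > 0"
    and lead: "lead_coeff W * \<rho> ^ n = of_real m"
begin

text \<open>The principal n-th root, cut along the negative reals, opposite to the bisector of the
  sector. Its domain has twice the opening of the half plane Re z > 0, so estimates can cross the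
  boundary half-lines of the Stokes sector.\<close>

definition X :: "complex \<Rightarrow> complex" where "X z = \<rho> * exp (Ln (z / of_real m) / of_nat n)"
definition A :: "complex \<Rightarrow> complex" where
  "A z = deriv \<psi> (X z) + poly (pderiv W) (X z) * \<psi> (X z)"
definition B :: "complex \<Rightarrow> complex" where
  "B z = deriv \<psi> (X z) - poly (pderiv W) (X z) * \<psi> (X z)"
definition w :: "complex \<Rightarrow> complex" where
  "w z = poly (pderiv W) (X z) * (X z / (of_nat n * z))"
text \<open>Differentiating A in x leaves W' A + (W'' - r) \<psi>. With \<psi> = (A - B) / (2 W')
  the remainder becomes a multiple of A - B; the last factor is dX/dz. For B the sign of W''
  flips.\<close>

definition a :: "complex \<Rightarrow> complex" where
  "a z = poly (pderiv (pderiv W) - r) (X z) / (2 * poly (pderiv W) (X z)) * (X z / (of_nat n * z))"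
definition b :: "complex \<Rightarrow> complex" where
  "b z = poly (- pderiv (pderiv W) - r) (X z) / (2 * poly (pderiv W) (X z)) * (X z / (of_nat n * z))"

text \<open>The crude constant 1 suffices, because amplification along forward rays improves it to
  any other. The negation supplies points arbitrarily far to the right with |A| > |B|, any one of
  which can seed the growth.\<close>

definition small :: bool where "small \<longleftrightarrow> (\<exists>R. \<forall>z. Re z \<ge> R \<longrightarrow> cmod (A z) \<le> cmod (B z))"

section \<open>The uniformising coordinate and the limits of the coefficients\<close>

lemma X_nonzero [simp]: "X z \<noteq> 0"
  using norm_rho by (auto simp: X_def)

lemma X_power: assumes "z \<noteq> 0" shows "X z ^ n = \<rho> ^ n * (z / of_real m)"
proof -
  have "exp (Ln (z / of_real m) / of_nat n) ^ n = exp (of_nat n * (Ln (z / of_real m) / of_nat n))"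
    by (rule exp_of_nat_mult[symmetric])
  also have "\<dots> = z / of_real m" using n2 assms m_pos by simp
  finally show ?thesis by (simp add: X_def power_mult_distrib)
qed

lemma lead_X_power: assumes "z \<noteq> 0" shows "lead_coeff W * X z ^ n = z"
  using lead m_pos by (simp add: X_power[OF assms] mult.assoc[symmetric])

lemma norm_X_power: assumes "z \<noteq> 0" shows "cmod (X z) ^ n = cmod z / m"
proof -
  have "cmod (X z) ^ n = cmod (X z ^ n)" by (simp add: norm_power)
  also have "\<dots> = cmod z / m"
    using m_pos norm_rho by (simp add: X_power[OF assms] norm_mult norm_power norm_divide)
  finally show ?thesis .
qed

lemma X_polar:
  assumes "s > 0" "\<bar>\<theta>\<bar> < pi"
  shows "X (of_real (m * s ^ n) * cis \<theta>) = \<rho> * (of_real s * cis (\<theta> / n))"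
proof -
  have "Ln (of_real (m * s ^ n) * cis \<theta> / of_real m) = of_real (n * ln s) + \<i> * of_real \<theta>"
  proof (rule Ln_unique)
    show "exp (of_real (n * ln s) + \<i> * of_real \<theta>) = of_real (m * s ^ n) * cis \<theta> / of_real m"
      using assms m_pos
      by (simp add: exp_add cis_conv_exp exp_of_nat_mult mult.commute flip: of_real_exp)
  qed (use assms in auto)
  then have "X (of_real (m * s ^ n) * cis \<theta>) = \<rho> * exp (of_real (ln s) + \<i> * of_real (\<theta> / n))"
    using n2 by (simp add: X_def add_divide_distrib)
  also have "\<dots> = \<rho> * (of_real s * cis (\<theta> / n))"
    using assms by (simp add: exp_add cis_conv_exp exp_of_real)
  finally show ?thesis .
qed

lemma X_at_infinity: "filterlim X at_infinity at_infinity"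
  unfolding filterlim_at_infinity[OF order_refl]
proof (intro allI impI)
  fix M :: real assume M: "0 < M"
  show "\<forall>\<^sub>F z in at_infinity. M \<le> cmod (X z)"
  proof (rule eventually_at_infinityI)
    fix z assume z: "m * M ^ n + 1 \<le> cmod z"
    have "0 < m * M ^ n" using M m_pos by simp
    with z have "z \<noteq> 0" by auto
    have "M ^ n \<le> cmod z / m" using z m_pos by (simp add: field_simps)
    also have "\<dots> = cmod (X z) ^ n" using norm_X_power[OF \<open>z \<noteq> 0\<close>] by simp
    finally show "M \<le> cmod (X z)" using n2 by (simp add: power_mono_iff M less_imp_le)
  qed
qed

lemma X_deriv:
  assumes "z \<notin> \<real>\<^sub>\<le>\<^sub>0"
  shows "(X has_field_derivative X z / (of_nat n * z)) (at z)"
proof -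
  have z0: "z \<noteq> 0" using assms by auto
  have "z / of_real m \<notin> \<real>\<^sub>\<le>\<^sub>0"
    using assms m_pos by (auto simp: complex_nonpos_Reals_iff field_simps)
  then show ?thesis unfolding X_def
    by (auto intro!: derivative_eq_intros) (use z0 n2 m_pos in \<open>auto simp: field_simps\<close>)
qed

lemma degree_pderiv_W: "degree (pderiv W) = n - 1"
  by (simp add: degree_pderiv deg_W)

lemma psi_deriv: "(\<psi> has_field_derivative deriv \<psi> x) (at x)"
  using hol by (simp add: holomorphic_derivI)

lemma deriv_psi_deriv: "(deriv \<psi> has_field_derivative poly ((pderiv W)\<^sup>2 - r) x * \<psi> x) (at x)"
  using holomorphic_derivI[OF holomorphic_deriv[OF hol open_UNIV] open_UNIV UNIV_I, of x UNIV]
  by (simp only: ode)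

lemma w_tendsto: "(w \<longlongrightarrow> 1) at_infinity"
proof -
  have lc: "lead_coeff W \<noteq> 0" using lead m_pos by auto
  have "((\<lambda>x. poly (pderiv W) x / x ^ (n - 1)) \<longlongrightarrow> lead_coeff (pderiv W)) at_infinity"
    using poly_divide_tendsto_aux[of "pderiv W"] by (simp add: degree_pderiv_W)
  from filterlim_compose[OF this X_at_infinity]
  have "((\<lambda>z. poly (pderiv W) (X z) / X z ^ (n - 1) / (of_nat n * lead_coeff W))
      \<longlongrightarrow> lead_coeff (pderiv W) / (of_nat n * lead_coeff W)) at_infinity"
    by (rule tendsto_divide) (use lc n2 in auto)
  moreover have "lead_coeff (pderiv W) = of_nat n * lead_coeff W"
    using n2 by (simp add: degree_pderiv_W coeff_pderiv deg_W)
  ultimately have "((\<lambda>z. poly (pderiv W) (X z) / X z ^ (n - 1) / (of_nat n * lead_coeff W))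
      \<longlongrightarrow> 1) at_infinity" using lc n2 by simp
  moreover have "\<forall>\<^sub>F z in at_infinity. poly (pderiv W) (X z) / X z ^ (n - 1) / (of_nat n * lead_coeff W) = w z"
  proof (rule eventually_at_infinityI)
    fix z :: complex assume "1 \<le> cmod z"
    then have z: "z \<noteq> 0" by auto
    have "X z ^ n = X z * X z ^ (n - 1)" using n2 by (cases n) auto
    with lead_X_power[OF z] have "z = lead_coeff W * (X z * X z ^ (n - 1))" by simp
    then show "poly (pderiv W) (X z) / X z ^ (n - 1) / (of_nat n * lead_coeff W) = w z"
      unfolding w_def using z lc n2 by (simp add: field_simps)
  qed
  ultimately show ?thesis by (rule Lim_transform_eventually)
qed

text \<open>Expressing dX/dz through \<open>w\<close> turns the function into (q / W'^2) (w / 2), so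
  the degree condition is just deg q < deg W'^2.\<close>

lemma lower_order_tendsto:
  assumes "degree q < 2 * (n - 1)"
  shows "((\<lambda>z. poly q (X z) / (2 * poly (pderiv W) (X z)) * (X z / (of_nat n * z))) \<longlongrightarrow> 0) at_infinity"
proof -
  have "degree ((pderiv W)\<^sup>2) = 2 * (n - 1)" 
    using n2 by (subst degree_power_eq) (auto simp: degree_pderiv_W pderiv_eq_0_iff deg_W)
  then have "((\<lambda>x. poly q x / poly ((pderiv W)\<^sup>2) x) \<longlongrightarrow> 0) at_infinity"
    using assms by (intro poly_divide_tendsto_0_at_infinity) auto
  from filterlim_compose[OF this X_at_infinity]
  have "((\<lambda>z. poly q (X z) / poly ((pderiv W)\<^sup>2) (X z) * (w z / 2)) \<longlongrightarrow> 0 * (1 / 2)) at_infinity"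
    by (intro tendsto_intros w_tendsto) auto
  moreover have "poly q x / poly ((pderiv W)\<^sup>2) x * (poly (pderiv W) x * y / 2)
      = poly q x / (2 * poly (pderiv W) x) * y" for x y
    by (cases "poly (pderiv W) x = 0") (auto simp: power2_eq_square)
  ultimately show ?thesis by (simp only: w_def mult_zero_left)
qed

lemma ab_tendsto: "(a \<longlongrightarrow> 0) at_infinity" "(b \<longlongrightarrow> 0) at_infinity"
proof -
  have "degree (pderiv (pderiv W)) < 2 * (n - 1)" using n2 by (simp add: degree_pderiv deg_W)
  then have "degree (pderiv (pderiv W) - r) < 2 * (n - 1)" "degree (- pderiv (pderiv W) - r) < 2 * (n - 1)"
    using deg_r by (auto intro!: degree_diff_less)
  then show "(a \<longlongrightarrow> 0) at_infinity" "(b \<longlongrightarrow> 0) at_infinity"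
    unfolding a_def b_def by (intro lower_order_tendsto; simp)+
qed

text \<open>The last bound concerns 1/(n z) = X'/X, the logarithmic derivative of the factor X that
  is divided out of \<psi> in \<open>E\<close>.\<close>

definition far :: "real \<Rightarrow> real \<Rightarrow> bool" where
  "far \<eta> R \<longleftrightarrow> R > 0 \<and> (\<forall>z. cmod z \<ge> R \<longrightarrow> cmod (w z - 1) \<le> \<eta> \<and> cmod (a z) \<le> \<eta> \<and> cmod (b z) \<le> \<eta> \<and>
      poly (pderiv W) (X z) \<noteq> 0 \<and> cmod (1 / (of_nat n * z)) \<le> \<eta>)"

lemma far_exists:
  assumes "\<eta> > 0"
  obtains R where "far \<eta> R"
proof -
  have "\<forall>\<^sub>F z in at_infinity. dist (w z) 1 < min \<eta> 1"
    using w_tendsto assms by (intro tendstoD) auto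
  moreover have "\<forall>\<^sub>F z in at_infinity. dist (a z) 0 < \<eta>" "\<forall>\<^sub>F z in at_infinity. dist (b z) 0 < \<eta>"
    using ab_tendsto assms by (blast intro: tendstoD)+
  moreover have "\<forall>\<^sub>F z in at_infinity. cmod (1 / (of_nat n * z)) \<le> \<eta>"
  proof (rule eventually_at_infinityI)
    fix z :: complex assume z: "1 / \<eta> \<le> cmod z"
    have "0 < 1 / \<eta>" using assms by simp
    with z have z0: "cmod z > 0" by linarith
    have "cmod z \<le> real n * cmod z" using n2 z0 by simp
    then have "1 / (real n * cmod z) \<le> 1 / cmod z" using z0 by (intro divide_left_mono) auto
    also have "\<dots> \<le> \<eta>" using z z0 assms by (simp add: field_simps)
    finally show "cmod (1 / (of_nat n * z)) \<le> \<eta>" by (simp add: norm_divide norm_mult)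
  qed
  ultimately have "\<forall>\<^sub>F z in at_infinity. cmod (w z - 1) \<le> \<eta> \<and> cmod (a z) \<le> \<eta> \<and> cmod (b z) \<le> \<eta> \<and>
      poly (pderiv W) (X z) \<noteq> 0 \<and> cmod (1 / (of_nat n * z)) \<le> \<eta>"
    by eventually_elim (auto simp: dist_norm w_def)
  then obtain R where "\<forall>z. cmod z \<ge> R \<longrightarrow> cmod (w z - 1) \<le> \<eta> \<and> cmod (a z) \<le> \<eta> \<and> cmod (b z) \<le> \<eta> \<and>
      poly (pderiv W) (X z) \<noteq> 0 \<and> cmod (1 / (of_nat n * z)) \<le> \<eta>"
    unfolding eventually_at_infinity by auto
  then have "far \<eta> (max R 1)" by (auto simp: far_def)
  then show thesis using that by blast
qed

lemma AB_deriv: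
  assumes "z \<notin> \<real>\<^sub>\<le>\<^sub>0" "poly (pderiv W) (X z) \<noteq> 0"
  shows "(A has_field_derivative (w z * A z + a z * (A z - B z))) (at z)"
    and "(B has_field_derivative (- w z * B z + b z * (A z - B z))) (at z)"
proof -
  define D where "D = X z / (of_nat n * z)"
  have 1: "((\<lambda>z. deriv \<psi> (X z)) has_field_derivative poly ((pderiv W)\<^sup>2 - r) (X z) * \<psi> (X z) * D) (at z)"
    using DERIV_chain2[OF deriv_psi_deriv X_deriv[OF assms(1)]] by (simp add: D_def)
  have 2: "((\<lambda>z. \<psi> (X z)) has_field_derivative deriv \<psi> (X z) * D) (at z)"
    using DERIV_chain2[OF psi_deriv X_deriv[OF assms(1)]] by (simp add: D_def)
  have 3: "((\<lambda>z. poly (pderiv W) (X z)) has_field_derivative poly (pderiv (pderiv W)) (X z) * D) (at z)"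
    using DERIV_chain2[OF poly_DERIV X_deriv[OF assms(1)]] by (simp add: D_def)
  show "(A has_field_derivative (w z * A z + a z * (A z - B z))) (at z)"
    unfolding A_def[abs_def] by (rule DERIV_cong[OF DERIV_add[OF 1 DERIV_mult[OF 3 2]]])
      (use assms(2) in \<open>simp add: w_def a_def B_def flip: D_def, simp add: field_simps power2_eq_square\<close>)
  show "(B has_field_derivative (- w z * B z + b z * (A z - B z))) (at z)"
    unfolding B_def[abs_def] by (rule DERIV_cong[OF DERIV_diff[OF 1 DERIV_mult[OF 3 2]]])
      (use assms(2) in \<open>simp add: w_def b_def A_def flip: D_def, simp add: field_simps power2_eq_square\<close>)
qed

lemma AB_nonzero:
  assumes "poly (pderiv W) (X z) \<noteq> 0"
  shows "A z \<noteq> 0 \<or> B z \<noteq> 0"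
proof (rule ccontr)
  assume "\<not> (A z \<noteq> 0 \<or> B z \<noteq> 0)"
  then have AB: "A z = 0" "B z = 0" by auto
  have "2 * deriv \<psi> (X z) = A z + B z" "2 * (poly (pderiv W) (X z) * \<psi> (X z)) = A z - B z"
    by (simp_all add: A_def B_def)
  with AB assms have "\<psi> (X z) = 0" "deriv \<psi> (X z) = 0" by auto
  moreover have "poly ((pderiv W)\<^sup>2 - r) holomorphic_on UNIV"
    unfolding holomorphic_on_def field_differentiable_def
    by (blast intro: poly_DERIV has_field_derivative_at_within)
  ultimately show False using linear_ode_unique_zero[OF hol _ ode] nz by blast
qed

section \<open>The dichotomy: solutions small or large in a sector\<close>

lemma forward_growth:
  assumes far: "far \<eta> R" and c: "c > 0" and k: "k > 0" "k' > 0"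
    and eta: "\<eta> * (4 + k + 1 / k) \<le> c" "\<eta> * (4 + k' + 1 / k') \<le> c"
    and e: "cmod e = 1" "Re e \<ge> c" and s: "s \<ge> 0"
    and dom: "\<And>t. 0 \<le> t \<Longrightarrow> t \<le> s \<Longrightarrow> cmod (z + of_real t * e) \<ge> R \<and> z + of_real t * e \<notin> \<real>\<^sub>\<le>\<^sub>0"
    and pos: "cmod (A z) > k * cmod (B z)"
  shows "(cmod (A (z + of_real s * e)))\<^sup>2 - k'\<^sup>2 * (cmod (B (z + of_real s * e)))\<^sup>2
    \<ge> (cmod (A z))\<^sup>2 - k'\<^sup>2 * (cmod (B z))\<^sup>2 + c * s * ((cmod (A z))\<^sup>2 - k\<^sup>2 * (cmod (B z))\<^sup>2)"
proof (rule cone_growth[where A=A and B=B and w=w and a=a and b=b and \<eta>=\<eta>, OF e c k _ eta s pos])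
  fix t assume "0 \<le> t" "t \<le> s"
  then show "let y = z + of_real t * e in
        (A has_field_derivative (w y * A y + a y * (A y - B y))) (at y) \<and>
        (B has_field_derivative (- w y * B y + b y * (A y - B y))) (at y) \<and>
        cmod (w y - 1) \<le> \<eta> \<and> cmod (a y) \<le> \<eta> \<and> cmod (b y) \<le> \<eta>"
    using dom[of t] far AB_deriv[of "z + of_real t * e"] unfolding Let_def far_def by blast
qed

text \<open>A point with |A| > \<kappa> |B| would be carried by the horizontal forward ray to points
  far right with |A| > |B|, against smallness. Such a ray keeps Im z, so it stays far from the
  origin and off the cut even when it starts with Re z < 0; hence the region reaches beyond the half
  plane.\<close>

lemma small_region:
  assumes "small" and \<kappa>: "0 < \<kappa>"
  obtains R where "R > 0" "\<And>z. Re z \<ge> R \<or> \<bar>Im z\<bar> \<ge> R \<Longrightarrow> cmod (A z) \<le> \<kappa> * cmod (B z)"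
proof -
  obtain R0 where R0: "\<And>z. Re z \<ge> R0 \<Longrightarrow> cmod (A z) \<le> cmod (B z)"
    using assms(1) by (auto simp: small_def)
  define \<eta> where "\<eta> = min (1 / (4 + \<kappa> + 1 / \<kappa>)) (1 / 6)"
  have pos: "4 + \<kappa> + 1 / \<kappa> > 0" using \<kappa> by (intro add_pos_pos) auto
  have "\<eta> > 0" using pos by (simp add: \<eta>_def)
  have "\<eta> * (4 + \<kappa> + 1 / \<kappa>) \<le> 1 / (4 + \<kappa> + 1 / \<kappa>) * (4 + \<kappa> + 1 / \<kappa>)"
    using pos by (intro mult_right_mono) (auto simp: \<eta>_def)
  then have eta: "\<eta> * (4 + \<kappa> + 1 / \<kappa>) \<le> 1" "\<eta> * (4 + 1 + 1 / 1) \<le> 1"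
    using pos by (auto simp: \<eta>_def)
  obtain R where far: "far \<eta> R" using far_exists[OF \<open>\<eta> > 0\<close>] .
  show thesis
  proof (rule that)
    show "R > 0" using far by (simp add: far_def)
    fix z assume z: "Re z \<ge> R \<or> \<bar>Im z\<bar> \<ge> R"
    show "cmod (A z) \<le> \<kappa> * cmod (B z)"
    proof (rule ccontr)
      assume "\<not> cmod (A z) \<le> \<kappa> * cmod (B z)"
      then have gt: "cmod (A z) > \<kappa> * cmod (B z)" by simp
      have "(\<kappa> * cmod (B z))\<^sup>2 < (cmod (A z))\<^sup>2"
        using gt \<kappa> by (intro power_strict_mono) auto
      then have d: "(cmod (A z))\<^sup>2 - \<kappa>\<^sup>2 * (cmod (B z))\<^sup>2 > 0" by (simp add: power_mult_distrib)
      define \<delta> where "\<delta> = (cmod (A z))\<^sup>2 - \<kappa>\<^sup>2 * (cmod (B z))\<^sup>2"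
      \<comment> \<open>Long enough to pass R0 and to let the linear gain s * \<delta> exceed |B
        z|^2, the most that |A|^2 - |B|^2 can lack at the start.\<close>
      define s where "s = max (max 0 (R0 - Re z)) (((cmod (B z))\<^sup>2 + 1) / \<delta>)"
      have s: "s \<ge> 0" "Re z + s \<ge> R0" "s * \<delta> \<ge> (cmod (B z))\<^sup>2 + 1"
        using d by (auto simp: s_def \<delta>_def[symmetric] pos_divide_le_eq[symmetric])
      have "(cmod (A (z + of_real s * 1)))\<^sup>2 - 1\<^sup>2 * (cmod (B (z + of_real s * 1)))\<^sup>2
        \<ge> (cmod (A z))\<^sup>2 - 1\<^sup>2 * (cmod (B z))\<^sup>2 + 1 * s * ((cmod (A z))\<^sup>2 - \<kappa>\<^sup>2 * (cmod (B z))\<^sup>2)"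
      proof (rule forward_growth[OF far _ \<kappa> _ eta _ _ s(1) _ gt])
        fix t assume t: "0 \<le> t" "t \<le> s"
        have "\<bar>Im z\<bar> \<le> cmod (z + of_real t * 1)" "Re z + t \<le> cmod (z + of_real t * 1)"
          using abs_Im_le_cmod[of "z + of_real t"] complex_Re_le_cmod[of "z + of_real t"] by auto
        then show "cmod (z + of_real t * 1) \<ge> R \<and> z + of_real t * 1 \<notin> \<real>\<^sub>\<le>\<^sub>0"
          using z t far by (auto simp: far_def complex_nonpos_Reals_iff)
      qed auto
      then have "(cmod (A (z + of_real s)))\<^sup>2 - (cmod (B (z + of_real s)))\<^sup>2 > 0"
        using s(3) by (simp add: \<delta>_def[symmetric]) (smt (verit) zero_le_power2)
      moreover have "(cmod (A (z + of_real s)))\<^sup>2 \<le> (cmod (B (z + of_real s)))\<^sup>2"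
        using R0[of "z + of_real s"] s by (intro power_mono) auto
      ultimately show False by simp
    qed
  qed
qed

text \<open>A single seed z1 with |A| > |B| serves the whole cone: every distant z is reached from
  z1 in a direction of real part at least c/2, and the gain grows with the distance.\<close>

lemma large_cone:
  assumes "\<not> small" and \<kappa>: "0 < \<kappa>" and c: "0 < c" "c \<le> 1"
  obtains R where "R > 0" "\<And>z. cmod z \<ge> R \<Longrightarrow> Re z \<ge> c * cmod z \<Longrightarrow> cmod (B z) \<le> \<kappa> * cmod (A z)"
proof -
  define \<kappa>' where "\<kappa>' = 1 / \<kappa>"
  have \<kappa>': "\<kappa>' > 0" using \<kappa> by (simp add: \<kappa>'_def)
  define \<eta> where "\<eta> = min (c / 2 / (4 + \<kappa>' + 1 / \<kappa>')) (c / 2 / 6)"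
  have pos: "4 + \<kappa>' + 1 / \<kappa>' > 0" using \<kappa>' by (intro add_pos_pos) auto
  have "\<eta> > 0" using pos c by (simp add: \<eta>_def)
  have "\<eta> * (4 + \<kappa>' + 1 / \<kappa>') \<le> c / 2 / (4 + \<kappa>' + 1 / \<kappa>') * (4 + \<kappa>' + 1 / \<kappa>')"
    using pos by (intro mult_right_mono) (auto simp: \<eta>_def)
  also have "\<dots> = c / 2" using pos by (metis nonzero_eq_divide_eq less_irrefl)
  finally have eta: "\<eta> * (4 + 1 + 1 / 1) \<le> c / 2" "\<eta> * (4 + \<kappa>' + 1 / \<kappa>') \<le> c / 2"
    using pos by (auto simp: \<eta>_def)
  obtain R where far: "far \<eta> R" using far_exists[OF \<open>\<eta> > 0\<close>] .
  obtain z1 where z1: "Re z1 \<ge> R" "cmod (A z1) > 1 * cmod (B z1)"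
    using assms(1) by (force simp: small_def not_le)
  define \<delta> where "\<delta> = (cmod (A z1))\<^sup>2 - 1\<^sup>2 * (cmod (B z1))\<^sup>2"
  have \<delta>: "\<delta> > 0" using z1 power_strict_mono[of "cmod (B z1)" "cmod (A z1)" 2] by (simp add: \<delta>_def)
  \<comment> \<open>The distance after which the gain c/2 * s * \<delta> repays the initial deficit,
    at most \<kappa>'^2 |B z1|^2.\<close>
  define S where "S = \<kappa>'\<^sup>2 * (cmod (B z1))\<^sup>2 / (c / 2 * \<delta>)"
  define R' where "R' = max ((1 + 2 / c) * cmod z1 + 1) (cmod z1 + S)"
  show thesis
  proof (rule that)
    have "(1 + 2 / c) * cmod z1 + 1 > 0" using c by (intro add_nonneg_pos) auto
    then show "R' > 0" by (simp add: R'_def)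
    fix z assume z: "cmod z \<ge> R'" "Re z \<ge> c * cmod z"
    then have "cmod z > (1 + 2 / c) * cmod z1" by (simp add: R'_def)
    from unit_direction[OF c z(2) this] obtain e where e: "cmod e = 1" "Re e \<ge> c / 2"
      "z = z1 + of_real (cmod (z - z1)) * e" by blast
    define s where "s = cmod (z - z1)"
    have s: "s \<ge> S" using norm_triangle_ineq2[of z z1] z(1) by (simp add: s_def R'_def)
    have "(cmod (A (z1 + of_real s * e)))\<^sup>2 - \<kappa>'\<^sup>2 * (cmod (B (z1 + of_real s * e)))\<^sup>2
        \<ge> (cmod (A z1))\<^sup>2 - \<kappa>'\<^sup>2 * (cmod (B z1))\<^sup>2 + c / 2 * s * ((cmod (A z1))\<^sup>2 - 1\<^sup>2 * (cmod (B z1))\<^sup>2)"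
    proof (rule forward_growth[OF far _ _ \<kappa>' eta e(1,2) _ _ z1(2)])
      fix t assume t: "0 \<le> t" "t \<le> s"
      have "0 \<le> t * Re e" using t e c by simp
      then have "R \<le> Re (z1 + of_real t * e)" using z1 by simp
      moreover have "R > 0" using far by (simp add: far_def)
      ultimately show "cmod (z1 + of_real t * e) \<ge> R \<and> z1 + of_real t * e \<notin> \<real>\<^sub>\<le>\<^sub>0"
        using complex_Re_le_cmod[of "z1 + of_real t * e"] by (auto simp: complex_nonpos_Reals_iff)
    qed (use c in \<open>auto simp: s_def\<close>)
    then have "(cmod (A z))\<^sup>2 - \<kappa>'\<^sup>2 * (cmod (B z))\<^sup>2
        \<ge> (cmod (A z1))\<^sup>2 - \<kappa>'\<^sup>2 * (cmod (B z1))\<^sup>2 + c / 2 * s * \<delta>"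
      using e(3) by (simp add: s_def \<delta>_def)
    moreover have "c / 2 * s * \<delta> \<ge> \<kappa>'\<^sup>2 * (cmod (B z1))\<^sup>2"
      using s c \<delta> unfolding S_def by (simp add: pos_divide_le_eq mult_ac)
    ultimately have "\<kappa>'\<^sup>2 * (cmod (B z))\<^sup>2 \<le> (cmod (A z))\<^sup>2"
      by (smt (verit) zero_le_power2)
    then have "(\<kappa>' * cmod (B z))\<^sup>2 \<le> (cmod (A z))\<^sup>2" by (simp add: power_mult_distrib)
    then have "\<kappa>' * cmod (B z) \<le> cmod (A z)" by (rule power2_le_imp_le) simp
    then show "cmod (B z) \<le> \<kappa> * cmod (A z)" using \<kappa> by (simp add: \<kappa>'_def field_simps)
  qed
qed

section \<open>Exponential rates and primitives of h \<psi>^2\<close>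

definition E :: "complex \<Rightarrow> complex" where "E z = (\<psi> (X z) / X z)\<^sup>2"
text \<open>The logarithmic derivative of \<open>E\<close> in z: (A + B)/(A - B) is
  \<psi>'/(W'\<psi>), \<open>w\<close> is W' X', and 1/(n z) is X'/X. It is close to 2 where B is
  negligible and to -2 where A is.\<close>

definition lam :: "complex \<Rightarrow> complex" where
  "lam z = 2 * (w z * ((A z + B z) / (A z - B z)) - 1 / (of_nat n * z))"

lemma A_minus_B: "A z - B z = 2 * poly (pderiv W) (X z) * \<psi> (X z)"
  and A_plus_B: "A z + B z = 2 * deriv \<psi> (X z)"
  by (simp_all add: A_def B_def)

lemma E_deriv:
  assumes "z \<notin> \<real>\<^sub>\<le>\<^sub>0" "A z \<noteq> B z"
  shows "(E has_field_derivative (lam z * E z)) (at z)"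
proof -
  have nz: "poly (pderiv W) (X z) \<noteq> 0" "\<psi> (X z) \<noteq> 0"
    using A_minus_B[of z] assms(2) by auto
  have z0: "z \<noteq> 0" using assms by auto
  define D where "D = X z / (of_nat n * z)"
  have D: "D \<noteq> 0" using z0 n2 by (simp add: D_def)
  have inv: "1 / (of_nat n * z) = D / X z" by (simp add: D_def)
  have 2: "((\<lambda>z. \<psi> (X z)) has_field_derivative deriv \<psi> (X z) * D) (at z)"
    using DERIV_chain2[OF psi_deriv X_deriv[OF assms(1)]] by (simp add: D_def)
  have 3: "(X has_field_derivative D) (at z)" using X_deriv[OF assms(1)] by (simp add: D_def)
  have lam: "lam z = 2 * (deriv \<psi> (X z) * D / \<psi> (X z) - D / X z)"
    unfolding lam_def A_minus_B A_plus_B w_def inv D_def[symmetric] using nz by simp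
  show ?thesis unfolding E_def[abs_def] lam
    by (rule DERIV_cong[OF DERIV_power[OF DERIV_divide[OF 2 3]]])
      (use nz in \<open>simp_all add: field_simps power2_eq_square\<close>)
qed

lemma rate_large:
  assumes c: "0 < c" "c \<le> 1" and far: "far (c / 20) R" and z: "cmod z \<ge> R"
    and le: "cmod (B z) \<le> c / 20 * cmod (A z)"
  shows "cmod (lam z - 2) \<le> c" "A z \<noteq> B z"
proof -
  have "A z \<noteq> 0" using AB_nonzero[of z] far z le c by (auto simp: far_def)
  from mobius_near_one[OF le c this] show "A z \<noteq> B z" by simp
  show "cmod (lam z - 2) \<le> c"
    unfolding lam_def using far z mobius_near_one[OF le c \<open>A z \<noteq> 0\<close>]
    by (intro rate_estimate c) (auto simp: far_def)
qed

lemma rate_small: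
  assumes c: "0 < c" "c \<le> 1" and far: "far (c / 20) R" and z: "cmod z \<ge> R"
    and le: "cmod (A z) \<le> c / 20 * cmod (B z)"
  shows "cmod (lam z + 2) \<le> c" "A z \<noteq> B z"
proof -
  have B0: "B z \<noteq> 0" using AB_nonzero[of z] far z le c by (auto simp: far_def)
  from mobius_near_one[OF le c this] show ne: "A z \<noteq> B z" by simp
  \<comment> \<open>Exchanging A and B changes the sign of the quotient, so the estimate of the
    large case applies once the sign of 1/(n z) is changed too.\<close>
  have neg: "(A z + B z) / (A z - B z) = - ((B z + A z) / (B z - A z))"
    using ne by (simp add: field_simps)
  have "cmod (2 * (w z * ((B z + A z) / (B z - A z)) - (- (1 / (of_nat n * z)))) - 2) \<le> c"
    using far z mobius_near_one[OF le c B0]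
    by (intro rate_estimate c) (auto simp: far_def)
  moreover have "lam z + 2 = - (2 * (w z * ((B z + A z) / (B z - A z)) - (- (1 / (of_nat n * z)))) - 2)"
    unfolding lam_def neg by (simp add: algebra_simps)
  ultimately show "cmod (lam z + 2) \<le> c" by (metis norm_minus_cancel)
qed

text \<open>The z-derivative of F is (h X^2 / W') w E. The degree condition makes the first factor
  bounded, and \<open>w\<close> tends to 1.\<close>

lemma primitive_bound:
  assumes F: "\<And>x. (F has_field_derivative poly h x * (\<psi> x)\<^sup>2) (at x)"
    and deg: "degree h + 2 \<le> n - 1"
  obtains C R where "C > 0" "\<And>z. z \<notin> \<real>\<^sub>\<le>\<^sub>0 \<Longrightarrow> cmod z \<ge> R \<Longrightarrow>
      ((\<lambda>z. F (X z)) has_field_derivative (poly h (X z) * (\<psi> (X z))\<^sup>2 * (X z / (of_nat n * z)))) (at z) \<and>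
      cmod (poly h (X z) * (\<psi> (X z))\<^sup>2 * (X z / (of_nat n * z))) \<le> C * cmod (E z)"
proof -
  have W0: "pderiv W \<noteq> 0" using n2 by (simp add: pderiv_eq_0_iff deg_W)
  define q where "q = h * monom 1 2"
  have dq: "degree q \<le> degree (pderiv W)"
    using deg degree_mult_le[of h "monom 1 2"] degree_monom_le[of "1::complex" 2]
    by (simp add: q_def degree_pderiv_W)
  obtain C0 R0 where C0: "\<And>x. cmod x \<ge> R0 \<Longrightarrow> cmod (poly q x / poly (pderiv W) x) \<le> C0"
  proof -
    \<comment> \<open>Comparing both polynomials with x^k also covers q of degree below k, whose
      limit is then coeff q k = 0.\<close>
    define k where "k = n - 1"
    have t: "((\<lambda>x. poly (pderiv W) x / x ^ k) \<longlongrightarrow> lead_coeff (pderiv W)) at_infinity"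
      using poly_divide_tendsto_aux[of "pderiv W"] by (simp add: degree_pderiv_W k_def)
    have t2: "((\<lambda>x. poly q x / x ^ k) \<longlongrightarrow> coeff q k) at_infinity"
    proof (cases "degree q = k")
      case True then show ?thesis using poly_divide_tendsto_aux[of q] by simp
    next
      case False
      then have "degree q < degree (monom (1::complex) k)"
        using dq by (simp add: degree_monom_eq degree_pderiv_W k_def)
      from poly_divide_tendsto_0_at_infinity[OF this] False dq show ?thesis
        by (simp add: poly_monom coeff_eq_0 degree_pderiv_W k_def)
    qed
    have "((\<lambda>x. poly q x / x ^ k / (poly (pderiv W) x / x ^ k)) \<longlongrightarrow> coeff q k / lead_coeff (pderiv W)) at_infinity"
      using W0 by (intro tendsto_divide t t2) auto
    then have "\<forall>\<^sub>F x in at_infinity. dist (poly q x / x ^ k / (poly (pderiv W) x / x ^ k)) (coeff q k / lead_coeff (pderiv W)) < 1"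
      by (rule tendstoD) simp
    then obtain R1 where R1: "\<And>x. cmod x \<ge> R1 \<Longrightarrow>
        dist (poly q x / x ^ k / (poly (pderiv W) x / x ^ k)) (coeff q k / lead_coeff (pderiv W)) < 1"
      unfolding eventually_at_infinity by blast
    show thesis
    proof (rule that)
      fix x assume x: "cmod x \<ge> max R1 1"
      then have "x \<noteq> 0" by auto
      then have eq: "poly q x / x ^ k / (poly (pderiv W) x / x ^ k) = poly q x / poly (pderiv W) x" by simp
      have "dist (poly q x / poly (pderiv W) x) (coeff q k / lead_coeff (pderiv W)) < 1"
        using R1[of x] x unfolding eq by (simp only: max.bounded_iff)
      then show "cmod (poly q x / poly (pderiv W) x) \<le> cmod (coeff q k / lead_coeff (pderiv W)) + 1"
        unfolding dist_norm using norm_triangle_ineq2[of "poly q x / poly (pderiv W) x" "coeff q k / lead_coeff (pderiv W)"]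
        by linarith
    qed
  qed
  obtain R1 where far: "far 1 R1" using far_exists[of 1] by auto
  have "\<forall>\<^sub>F z in at_infinity. cmod (X z) \<ge> max R0 1"
    using X_at_infinity unfolding filterlim_at_infinity[OF order_refl] by (metis less_max_iff_disj zero_less_one)
  then obtain R2 where R2: "\<And>z. cmod z \<ge> R2 \<Longrightarrow> cmod (X z) \<ge> R0"
    unfolding eventually_at_infinity by auto
  show thesis
  proof (rule that[of "max C0 1 * 2"])
    show "max C0 1 * 2 > 0" by simp
    fix z :: complex assume 2: "z \<notin> \<real>\<^sub>\<le>\<^sub>0" "cmod z \<ge> max R1 R2"
    then have z: "cmod z \<ge> R1" "cmod (X z) \<ge> R0" "cmod (w z - 1) \<le> 1" "poly (pderiv W) (X z) \<noteq> 0"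
      using R2[of z] far by (auto simp: far_def max_def split: if_splits)
    have "cmod (w z) \<le> cmod (w z - 1) + cmod 1" using norm_triangle_ineq[of "w z - 1" 1] by simp
    then have w2: "cmod (w z) \<le> 2" using z by simp
    have "poly h (X z) * (\<psi> (X z))\<^sup>2 * (X z / (of_nat n * z)) =
        (poly q (X z) / poly (pderiv W) (X z)) * w z * E z"
      using z(4) by (simp add: q_def poly_monom w_def E_def power_divide)
    then have "cmod (poly h (X z) * (\<psi> (X z))\<^sup>2 * (X z / (of_nat n * z))) =
        cmod (poly q (X z) / poly (pderiv W) (X z)) * cmod (w z) * cmod (E z)"
      by (simp only: norm_mult)
    also have "\<dots> \<le> max C0 1 * 2 * cmod (E z)"
      using w2 C0[OF z(2)] by (intro mult_right_mono mult_mono) auto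
    finally show "((\<lambda>z. F (X z)) has_field_derivative (poly h (X z) * (\<psi> (X z))\<^sup>2 * (X z / (of_nat n * z)))) (at z) \<and>
      cmod (poly h (X z) * (\<psi> (X z))\<^sup>2 * (X z / (of_nat n * z))) \<le> max C0 1 * 2 * cmod (E z)"
      using DERIV_chain2[OF F X_deriv[OF 2(1)]] by blast
  qed
qed

text \<open>Every distant point of the cone is joined to one point z1 on the positive axis by a
  segment inside the cone of aperture c/2, along which |E| increases. Since |E z| stays above |E
  z1|, it also absorbs the initial value F (X z1), so the bound holds for every primitive.\<close>

lemma large_bound:
  assumes large: "\<not> small"
    and F: "\<And>x. (F has_field_derivative poly h x * (\<psi> x)\<^sup>2) (at x)"
    and deg: "degree h + 2 \<le> n - 1"
    and c: "0 < c" "c \<le> 1"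
  obtains R K k where "K > 0" "k > 0" "\<And>z. cmod z \<ge> R \<Longrightarrow> Re z \<ge> c * cmod z \<Longrightarrow>
      \<psi> (X z) \<noteq> 0 \<and> cmod (F (X z)) \<le> K * cmod (E z) \<and> cmod (E z) \<ge> k * exp (c / 2 * cmod z)"
proof -
  define c1 where "c1 = c / 2"
  have c1: "0 < c1" "c1 \<le> 1" using c by (auto simp: c1_def)
  obtain R1 where R1: "R1 > 0"
    "\<And>z. cmod z \<ge> R1 \<Longrightarrow> Re z \<ge> c1 * cmod z \<Longrightarrow> cmod (B z) \<le> c1 / 20 * cmod (A z)"
    using large_cone[OF large _ c1, of "c1 / 20"] c1 by auto
  obtain R2 where far: "far (c1 / 20) R2" using far_exists[of "c1 / 20"] c1 by auto
  obtain C R3 where C: "C > 0" "\<And>z. z \<notin> \<real>\<^sub>\<le>\<^sub>0 \<Longrightarrow> cmod z \<ge> R3 \<Longrightarrow>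
      ((\<lambda>z. F (X z)) has_field_derivative (poly h (X z) * (\<psi> (X z))\<^sup>2 * (X z / (of_nat n * z)))) (at z) \<and>
      cmod (poly h (X z) * (\<psi> (X z))\<^sup>2 * (X z / (of_nat n * z))) \<le> C * cmod (E z)"
    using primitive_bound[OF F deg] by metis
  define R0 where "R0 = max R1 (max R2 R3)"
  have R0: "R0 > 0" using R1 by (simp add: R0_def)
  have in_cone: "z \<notin> \<real>\<^sub>\<le>\<^sub>0 \<and> cmod (lam z - 2) \<le> c1 \<and> A z \<noteq> B z"
    if "cmod z \<ge> R0" "Re z \<ge> c1 * cmod z" for z
  proof -
    have "c1 * cmod z > 0" using that R0 c1 by (intro mult_pos_pos) auto
    then show ?thesis
      using that rate_large[OF c1 far, of z] R1(2)[of z] by (auto simp: R0_def complex_nonpos_Reals_iff)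
  qed
  define z1 where "z1 = (of_real R0 :: complex)"
  have z1: "cmod z1 = R0" "Re z1 = R0" "c1 * R0 \<le> R0" using R0 c1 by (auto simp: z1_def)
  have E0: "E z \<noteq> 0" if "A z \<noteq> B z" for z
    using that A_minus_B[of z] by (auto simp: E_def)
  have Ez1: "cmod (E z1) > 0" using in_cone[of z1] z1 E0 by auto
  show thesis
  proof (rule that)
    show "cmod (F (X z1)) / cmod (E z1) + C / c1 > 0" "exp (- (c1 * R0)) * cmod (E z1) > 0"
      using c1 C Ez1 by (auto intro: add_nonneg_pos)
    fix z assume z: "cmod z \<ge> (1 + 2 / c) * R0 + 1" "Re z \<ge> c * cmod z"
    define s where "s = cmod (z - z1)"
    have s0: "s \<ge> 0" by (simp add: s_def)
    have "cmod z > (1 + 2 / c) * cmod z1" using z z1 by simp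
    from unit_direction[OF c z(2) this] obtain e where
      e: "cmod e = 1" "Re e \<ge> c1" "z1 + of_real s * e = z" unfolding c1_def s_def by metis
    have seg: "let y = z1 + of_real t * e in
        (E has_field_derivative (lam y * E y)) (at y) \<and> E y \<noteq> 0 \<and> Re (e * lam y) \<ge> c1 \<and>
        ((\<lambda>z. F (X z)) has_field_derivative (poly h (X y) * (\<psi> (X y))\<^sup>2 * (X y / (of_nat n * y)))) (at y) \<and>
        cmod (e * (poly h (X y) * (\<psi> (X y))\<^sup>2 * (X y / (of_nat n * y)))) \<le> C * cmod (E y)"
      if t: "0 \<le> t" "t \<le> s" for t
    proof -
      define y where "y = z1 + of_real t * e"
      have te: "c1 * t \<le> t * Re e" using e t mult_left_mono[of c1 "Re e" t] by (simp add: mult.commute)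
      then have Rey: "R0 + c1 * t \<le> Re y" using z1 by (simp add: y_def)
      have "0 \<le> c1 * t" using c1 t by simp
      then have "R0 \<le> cmod y" using Rey complex_Re_le_cmod[of y] by linarith
      moreover have "c1 * cmod y \<le> Re y"
      proof -
        have "cmod y \<le> R0 + t"
          unfolding y_def using norm_triangle_ineq[of z1 "of_real t * e"] z1 e t by (simp add: norm_mult)
        then have "c1 * cmod y \<le> c1 * R0 + c1 * t"
          using c1 mult_left_mono[of "cmod y" "R0 + t" c1] by (simp add: distrib_left)
        then show ?thesis using Rey z1 by linarith
      qed
      ultimately have y: "y \<notin> \<real>\<^sub>\<le>\<^sub>0" "cmod (lam y - 2) \<le> c1" "A y \<noteq> B y" "cmod y \<ge> R3"
        using in_cone[of y] by (auto simp: R0_def)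
      have "\<bar>Re (e * (lam y - 2))\<bar> \<le> c1"
        using abs_Re_le_cmod[of "e * (lam y - 2)"] y e by (simp add: norm_mult)
      then have "Re (e * lam y) \<ge> c1" using e by (simp add: algebra_simps)
      then show ?thesis
        using C(2)[OF y(1,4)] E_deriv[OF y(1,3)] E0[OF y(3)] e(1)
        unfolding Let_def y_def[symmetric] by (simp only: norm_mult[of e] mult_1) blast
    qed
    note g = segment_growth[OF s0 c1(1) _ seg, unfolded e(3)]
    have g1: "exp (c1 * s) * cmod (E z1) \<le> cmod (E z)" 
      and g2: "cmod (F (X z) - F (X z1)) \<le> C / c1 * cmod (E z)" using g C by auto
    have "1 * cmod (E z1) \<le> exp (c1 * s) * cmod (E z1)"
      using c1 s0 by (intro mult_right_mono) auto
    then have EE: "cmod (E z1) \<le> cmod (E z)" using g1 by simp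
    have "cmod (F (X z)) \<le> cmod (F (X z1)) / cmod (E z1) * cmod (E z1) + C / c1 * cmod (E z)"
      using g2 norm_triangle_ineq2[of "F (X z)" "F (X z1)"] Ez1 by simp
    also have "\<dots> \<le> cmod (F (X z1)) / cmod (E z1) * cmod (E z) + C / c1 * cmod (E z)"
      using EE by (intro add_right_mono mult_left_mono) auto
    finally have "cmod (F (X z)) \<le> (cmod (F (X z1)) / cmod (E z1) + C / c1) * cmod (E z)"
      by (simp add: distrib_right)
    moreover have "exp (- (c1 * R0)) * cmod (E z1) * exp (c / 2 * cmod z) \<le> cmod (E z)"
    proof -
      have "cmod z - R0 \<le> s" using norm_triangle_ineq2[of z z1] z1 by (simp add: s_def)
      then have "c1 * (cmod z - R0) \<le> c1 * s" using c1 by (intro mult_left_mono) auto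
      then have g3: "exp (c1 * cmod z - c1 * R0) * cmod (E z1) \<le> exp (c1 * s) * cmod (E z1)"
        by (intro mult_right_mono) (auto simp: algebra_simps)
      have "exp (- p) * u * exp q = exp (q - p) * u" for p q u :: real
        by (simp add: exp_diff exp_minus divide_inverse mult_ac)
      then show ?thesis using order_trans[OF g3 g1] unfolding c1_def by (simp only:)
    qed
    moreover have "\<psi> (X z) \<noteq> 0" using EE Ez1 by (auto simp: E_def)
    ultimately show "\<psi> (X z) \<noteq> 0 \<and>
         cmod (F (X z)) \<le> (cmod (F (X z1)) / cmod (E z1) + C / c1) * cmod (E z) \<and>
         exp (- (c1 * R0)) * cmod (E z1) * exp (c / 2 * cmod z) \<le> cmod (E z)" by blast
  qed
qed

text \<open>Here |E| decreases outwards, so the growth lemma is applied to the reversed segment,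
  from z + s e back to z. The variation of F is then measured by E at the inner end, uniformly in
  s.\<close>

lemma small_segment:
  assumes small: "small"
    and F: "\<And>x. (F has_field_derivative poly h x * (\<psi> x)\<^sup>2) (at x)"
    and deg: "degree h + 2 \<le> n - 1"
    and c: "0 < c" "c \<le> 1"
  obtains R K where "R > 0" "K > 0" "\<And>z e s. Re z \<ge> R \<Longrightarrow> cmod e = 1 \<Longrightarrow> Re e \<ge> c \<Longrightarrow> s \<ge> 0 \<Longrightarrow>
      \<psi> (X z) \<noteq> 0 \<and> cmod (E (z + of_real s * e)) \<le> exp (- (c * s)) * cmod (E z) \<and>
      cmod (F (X (z + of_real s * e)) - F (X z)) \<le> K * cmod (E z)"
proof -
  have "0 < c / 20" using c by simp
  from small_region[OF small this] obtain R1 where R1: "R1 > 0"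
    "\<And>z. Re z \<ge> R1 \<or> \<bar>Im z\<bar> \<ge> R1 \<Longrightarrow> cmod (A z) \<le> c / 20 * cmod (B z)" by blast
  obtain R2 where far: "far (c / 20) R2" using far_exists[of "c / 20"] c by auto
  obtain C R3 where C: "C > 0" "\<And>z. z \<notin> \<real>\<^sub>\<le>\<^sub>0 \<Longrightarrow> cmod z \<ge> R3 \<Longrightarrow>
      ((\<lambda>z. F (X z)) has_field_derivative (poly h (X z) * (\<psi> (X z))\<^sup>2 * (X z / (of_nat n * z)))) (at z) \<and>
      cmod (poly h (X z) * (\<psi> (X z))\<^sup>2 * (X z / (of_nat n * z))) \<le> C * cmod (E z)"
    using primitive_bound[OF F deg] by metis
  define R0 where "R0 = max R1 (max R2 R3)"
  have R0: "R0 > 0" using R1 by (simp add: R0_def)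
  show thesis
  proof (rule that)
    show "R0 > 0" "C / c > 0" using R0 C c by auto
    fix z e :: complex and s :: real
    assume z: "Re z \<ge> R0" and e: "cmod e = 1" "Re e \<ge> c" and s: "s \<ge> 0"
    define z' where "z' = z + of_real s * e"
    have z'z: "z' + of_real s * (- e) = z" by (simp add: z'_def)
    have seg: "let y = z' + of_real t * (- e) in
        (E has_field_derivative (lam y * E y)) (at y) \<and> E y \<noteq> 0 \<and> Re (- e * lam y) \<ge> c \<and>
        ((\<lambda>z. F (X z)) has_field_derivative (poly h (X y) * (\<psi> (X y))\<^sup>2 * (X y / (of_nat n * y)))) (at y) \<and>
        cmod (- e * (poly h (X y) * (\<psi> (X y))\<^sup>2 * (X y / (of_nat n * y)))) \<le> C * cmod (E y)"
      if t: "0 \<le> t" "t \<le> s" for t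
    proof -
      define y where "y = z' + of_real t * (- e)"
      have "0 \<le> (s - t) * Re e" using e t c by simp
      then have Rey: "Re y \<ge> R0" using z by (simp add: y_def z'_def algebra_simps)
      then have ny: "cmod y \<ge> R0" using complex_Re_le_cmod[of y] by linarith
      have y: "y \<notin> \<real>\<^sub>\<le>\<^sub>0" "cmod (lam y + 2) \<le> c" "A y \<noteq> B y" "cmod y \<ge> R3"
        using rate_small[OF c far, of y] R1(2)[of y] Rey ny R0 by (auto simp: R0_def complex_nonpos_Reals_iff)
      have "\<bar>Re (e * (lam y + 2))\<bar> \<le> c"
        using abs_Re_le_cmod[of "e * (lam y + 2)"] y e by (simp add: norm_mult)
      then have "Re (- e * lam y) \<ge> c" using e by (simp add: algebra_simps)
      moreover have "E y \<noteq> 0" using y(3) A_minus_B[of y] by (auto simp: E_def)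
      ultimately show ?thesis
        using C(2)[OF y(1,4)] E_deriv[OF y(1,3)] e(1)
        unfolding Let_def y_def[symmetric] by (simp only: norm_mult[of "- e"] norm_minus_cancel mult_1) blast
    qed
    note g = segment_growth[OF s c(1) _ seg, unfolded z'z]
    have g1: "exp (c * s) * cmod (E z') \<le> cmod (E z)"
      and g2: "cmod (F (X z) - F (X z')) \<le> C / c * cmod (E z)" using g C by auto
    have "E z \<noteq> 0" using seg[of s] s unfolding z'z Let_def by blast
    then have "\<psi> (X z) \<noteq> 0" by (auto simp: E_def)
    moreover have "cmod (E z') \<le> exp (- (c * s)) * cmod (E z)"
      using g1 by (simp add: exp_minus field_simps)
    ultimately show "\<psi> (X z) \<noteq> 0 \<and> cmod (E (z + of_real s * e)) \<le> exp (- (c * s)) * cmod (E z) \<and>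
      cmod (F (X (z + of_real s * e)) - F (X z)) \<le> C / c * cmod (E z)"
      using g2 unfolding z'_def[symmetric] by (simp add: norm_minus_commute)
  qed
qed

text \<open>Decay of E makes F (X t) Cauchy along the positive axis, and the segment estimate
  survives the passage to the limit with an error proportional to E at the near point. This
  proportionality, stronger than convergence, is what the later division by \<psi>^2
  requires.\<close>

lemma small_limit:
  assumes small: "small"
    and F: "\<And>x. (F has_field_derivative poly h x * (\<psi> x)\<^sup>2) (at x)"
    and deg: "degree h + 2 \<le> n - 1"
  obtains L R K where "K > 0" "\<And>t. t \<ge> R \<Longrightarrow> cmod (F (X (of_real t)) - L) \<le> K * cmod (E (of_real t))"
proof -
  obtain R K where R: "R > 0" "K > 0" and seg0: "\<And>z e s. Re z \<ge> R \<Longrightarrow> cmod e = 1 \<Longrightarrow> Re e \<ge> 1 \<Longrightarrow> s \<ge> 0 \<Longrightarrow>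
      \<psi> (X z) \<noteq> 0 \<and> cmod (E (z + of_real s * e)) \<le> exp (- (1 * s)) * cmod (E z) \<and>
      cmod (F (X (z + of_real s * e)) - F (X z)) \<le> K * cmod (E z)"
    using small_segment[OF small F deg, of 1] by auto
  have seg: "cmod (E (of_real t)) \<le> exp (- (t - u)) * cmod (E (of_real u)) \<and>
      cmod (F (X (of_real t)) - F (X (of_real u))) \<le> K * cmod (E (of_real u))" if "R \<le> u" "u \<le> t" for u t
    using seg0[of "of_real u" 1 "t - u"] that by simp
  define M where "M = cmod (E (of_real R))"
  have tail: "cmod (F (X (of_real t)) - F (X (of_real u))) \<le> K * (exp (- (u - R)) * M)" if "R \<le> u" "u \<le> t" for u t
  proof -
    have "cmod (F (X (of_real t)) - F (X (of_real u))) \<le> K * cmod (E (of_real u))" using seg that by blast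
    also have "\<dots> \<le> K * (exp (- (u - R)) * M)"
      using seg[of R u] that R by (intro mult_left_mono) (auto simp: M_def)
    finally show ?thesis .
  qed
  have lim0: "((\<lambda>u. K * (exp (- (u - R)) * M)) \<longlongrightarrow> 0) at_top"
  proof -
    have "filterlim (\<lambda>u::real. - R + u) at_top at_top"
      by (rule filterlim_tendsto_add_at_top[OF tendsto_const filterlim_ident])
    then have "filterlim (\<lambda>u::real. R - u) at_bot at_top"
      unfolding filterlim_uminus_at_bot by simp
    from tendsto_mult_right_zero[OF tendsto_mult_left_zero[OF filterlim_compose[OF exp_at_bot this]]]
    show ?thesis by simp
  qed
  have "Cauchy (\<lambda>N. F (X (of_real (real N))))"
  proof (rule CauchyI', unfold dist_norm)
    fix \<epsilon> :: real assume "\<epsilon> > 0"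
    with lim0 have "\<forall>\<^sub>F u in at_top. K * (exp (- (u - R)) * M) < \<epsilon>" by (rule order_tendstoD(2))
    then obtain u0 where u0: "\<And>u. u \<ge> u0 \<Longrightarrow> K * (exp (- (u - R)) * M) < \<epsilon>"
      unfolding eventually_at_top_linorder by blast
    obtain M0 :: nat where M0: "real M0 \<ge> max u0 R" using real_arch_simple by blast
    show "\<exists>M. \<forall>m\<ge>M. \<forall>n>m. cmod (F (X (of_real (real m))) - F (X (of_real (real n)))) < \<epsilon>"
    proof (intro exI[of _ M0] allI impI)
      fix i j assume ij: "i \<ge> M0" "j > i"
      then have "real i \<ge> R" "real i \<ge> u0" "real i \<le> real j" using M0 by linarith+
      then have "cmod (F (X (of_real (real j))) - F (X (of_real (real i)))) < \<epsilon>"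
        using tail[of "real i" "real j"] u0[of "real i"] by (blast intro: order_le_less_trans)
      then show "cmod (F (X (of_real (real i))) - F (X (of_real (real j)))) < \<epsilon>"
        by (subst norm_minus_commute)
    qed
  qed
  then obtain L where L: "(\<lambda>N. F (X (of_real (real N)))) \<longlonglongrightarrow> L"
    using Cauchy_convergent_iff convergentD by blast
  show thesis
  proof (rule that[OF R(2)])
    fix t assume t: "t \<ge> R"
    have "(\<lambda>N. cmod (F (X (of_real (real N))) - F (X (of_real t)))) \<longlonglongrightarrow> cmod (L - F (X (of_real t)))"
      by (intro tendsto_intros L)
    moreover have "\<forall>\<^sub>F N in sequentially. cmod (F (X (of_real (real N))) - F (X (of_real t))) \<le> K * cmod (E (of_real t))"
      using eventually_ge_at_top[of "nat \<lceil>t\<rceil>"]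
    proof eventually_elim
      case (elim N)
      then have "t \<le> real N" by linarith
      then show ?case using seg[OF t] by blast
    qed
    ultimately have "cmod (L - F (X (of_real t))) \<le> K * cmod (E (of_real t))"
      by (rule tendsto_upperbound) simp
    then show "cmod (F (X (of_real t)) - L) \<le> K * cmod (E (of_real t))" by (simp add: norm_minus_commute)
  qed
qed

text \<open>One L must serve all apertures c, so it is fixed on the positive axis before c is
  chosen; each z of a cone is then joined to that axis.\<close>

lemma small_bound:
  assumes small: "small"
    and F: "\<And>x. (F has_field_derivative poly h x * (\<psi> x)\<^sup>2) (at x)"
    and deg: "degree h + 2 \<le> n - 1"
  shows "\<exists>L. \<forall>c. 0 < c \<and> c \<le> 1 \<longrightarrow> (\<exists>R K k. K > 0 \<and> k > 0 \<and> (\<forall>z. cmod z \<ge> R \<longrightarrow> Re z \<ge> c * cmod z \<longrightarrow>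
      \<psi> (X z) \<noteq> 0 \<and> cmod (F (X z) - L) \<le> K * cmod (E z) \<and> cmod (E z) \<le> k * exp (- (c / 2 * cmod z))))"
proof -
  obtain L R1 K1 where K1: "K1 > 0"
    and L: "\<And>t. t \<ge> R1 \<Longrightarrow> cmod (F (X (of_real t)) - L) \<le> K1 * cmod (E (of_real t))"
    using small_limit[OF small F deg] by metis
  show ?thesis
  proof (intro exI[of _ L] allI impI, elim conjE)
    fix c :: real assume c: "0 < c" "c \<le> 1"
    obtain R2 K2 where R2: "R2 > 0" "K2 > 0" and seg: "\<And>z e s. Re z \<ge> R2 \<Longrightarrow> cmod e = 1 \<Longrightarrow> Re e \<ge> c / 2 \<Longrightarrow> s \<ge> 0 \<Longrightarrow>
      \<psi> (X z) \<noteq> 0 \<and> cmod (E (z + of_real s * e)) \<le> exp (- (c / 2 * s)) * cmod (E z) \<and>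
      cmod (F (X (z + of_real s * e)) - F (X z)) \<le> K2 * cmod (E z)"
      using small_segment[OF small F deg, of "c / 2"] c by auto
    define R where "R = max ((1 + 2 / c) * R2 + 1) (max R1 R2 / c)"
    define z1 where "z1 = (of_real R2 :: complex)"
    have z1: "cmod z1 = R2" "Re z1 = R2" using R2 by (auto simp: z1_def)
    have Ez1: "cmod (E z1) > 0" using seg[of z1 1 0] z1 c by (auto simp: E_def)
    have main: "\<psi> (X z) \<noteq> 0 \<and> cmod (F (X z) - L) \<le> (K2 + K1) * cmod (E z) \<and>
        cmod (E z) \<le> (exp (c / 2 * R2) * cmod (E z1)) * exp (- (c / 2 * cmod z))"
      if z: "cmod z \<ge> R" "Re z \<ge> c * cmod z" for z
    proof -
      have "max R1 R2 \<le> c * cmod z" using z(1) c by (simp add: R_def pos_divide_le_eq mult.commute)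
      then have Rez: "Re z \<ge> R1" "Re z \<ge> R2" using z by auto
      have z0: "cmod z > 0" using Rez R2 complex_Re_le_cmod[of z] by linarith
      have "cmod z > (1 + 2 / c) * cmod z1" using z z1 by (simp add: R_def)
      from unit_direction[OF c z(2) this] obtain e where
        e: "cmod e = 1" "Re e \<ge> c / 2" "z1 + of_real (cmod (z - z1)) * e = z" by metis
      have E1: "cmod (E z) \<le> exp (- (c / 2 * cmod (z - z1))) * cmod (E z1)"
        using seg[of z1 e "cmod (z - z1)"] e z1 by auto
      have "cmod z - R2 \<le> cmod (z - z1)" using norm_triangle_ineq2[of z z1] z1 by simp
      then have "c / 2 * (cmod z - R2) \<le> c / 2 * cmod (z - z1)" using c by (intro mult_left_mono) auto
      then have E1': "exp (- (c / 2 * cmod (z - z1))) * cmod (E z1) \<le> exp (c / 2 * R2 - c / 2 * cmod z) * cmod (E z1)"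
        by (intro mult_right_mono) (auto simp: algebra_simps)
      have "exp p * u * exp (- q) = exp (p - q) * u" for p q u :: real
        by (simp add: exp_diff exp_minus divide_inverse mult_ac)
      then have E2: "cmod (E z) \<le> (exp (c / 2 * R2) * cmod (E z1)) * exp (- (c / 2 * cmod z))"
        using order_trans[OF E1 E1'] by (simp only:)
      \<comment> \<open>The conjugate direction: z + |z| e' = z + cnj z = 2 Re z lies on the real
        axis, and Re e' = Re z / |z| is at least c.\<close>
      define e' where "e' = cnj z / of_real (cmod z)"
      have e': "cmod e' = 1" "Re e' \<ge> c / 2" "z + of_real (cmod z) * e' = of_real (2 * Re z)"
      proof -
        have "c \<le> Re z / cmod z" using z z0 by (simp add: pos_le_divide_eq)
        then have "c \<le> Re e'" by (simp add: e'_def)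
        then show "Re e' \<ge> c / 2" using c by simp
        show "z + of_real (cmod z) * e' = of_real (2 * Re z)" using z0
          by (simp add: e'_def complex_add_cnj)
      qed (use z0 in \<open>simp add: e'_def norm_divide\<close>)
      note sg = seg[OF Rez(2) e'(1,2) norm_ge_zero[of z], unfolded e'(3)]
      have E3: "cmod (E (of_real (2 * Re z))) \<le> cmod (E z)"
      proof -
        have "exp (- (c / 2 * cmod z)) * cmod (E z) \<le> 1 * cmod (E z)"
          using c by (intro mult_right_mono) auto
        then show ?thesis using sg by linarith
      qed
      have "2 * Re z \<ge> R1" using Rez R2 by linarith
      from L[OF this] have "cmod (F (X (of_real (2 * Re z))) - L) \<le> K1 * cmod (E (of_real (2 * Re z)))" .
      also have "\<dots> \<le> K1 * cmod (E z)" using E3 K1 by (intro mult_left_mono) auto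
      finally have "cmod (F (X z) - L) \<le> K2 * cmod (E z) + K1 * cmod (E z)"
        using sg norm_triangle_ineq[of "F (X z) - F (X (of_real (2 * Re z)))" "F (X (of_real (2 * Re z))) - L"]
        by (simp add: norm_minus_commute)
      then show ?thesis using sg E2 by (simp add: distrib_right)
    qed
    show "\<exists>R K k. K > 0 \<and> k > 0 \<and> (\<forall>z. cmod z \<ge> R \<longrightarrow> Re z \<ge> c * cmod z \<longrightarrow>
      \<psi> (X z) \<noteq> 0 \<and> cmod (F (X z) - L) \<le> K * cmod (E z) \<and> cmod (E z) \<le> k * exp (- (c / 2 * cmod z)))"
      by (rule exI[of _ R], rule exI[of _ "K2 + K1"], rule exI[of _ "exp (c / 2 * R2) * cmod (E z1)"])
        (use main K1 R2 Ez1 in auto)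
  qed
qed

section \<open>Return from the half plane to the Stokes sector\<close>

definition sector :: "real \<Rightarrow> complex set" where
  "sector \<delta> = {x. \<exists>s \<theta>. s > 0 \<and> \<bar>\<theta>\<bar> \<le> pi / (2 * real n) - \<delta> \<and> x = \<rho> * (of_real s * cis \<theta>)}"

text \<open>The n-th power turns the margin \<delta> into an angle n \<delta> from the imaginary
  axis, so c = sin (n \<delta>). A margin exceeding the half opening leaves an empty set, where any
  c will do.\<close>

lemma sector_cone:
  assumes "\<delta> > 0"
  obtains c where "0 < c" "c \<le> 1"
    "\<And>x. x \<in> sector \<delta> \<Longrightarrow> \<exists>z. X z = x \<and> Re z \<ge> c * cmod z \<and> cmod z = m * cmod x ^ n"
proof (cases "\<delta> \<le> pi / (2 * real n)")
  case False
  then have "sector \<delta> = {}" by (auto simp: sector_def)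
  then show ?thesis using that[of 1] by auto
next
  case True
  have n0: "real n > 0" using n2 by simp
  have nd: "0 < n * \<delta>" "n * \<delta> \<le> pi / 2" using assms True n0 by (auto simp: field_simps)
  show ?thesis
  proof (rule that)
    show "0 < sin (n * \<delta>)" using nd pi_gt_zero by (intro sin_gt_zero) linarith+
    show "sin (n * \<delta>) \<le> 1" by simp
    fix x assume "x \<in> sector \<delta>"
    then obtain s \<theta> where s: "s > 0" "\<bar>\<theta>\<bar> \<le> pi / (2 * real n) - \<delta>" "x = \<rho> * (of_real s * cis \<theta>)"
      by (auto simp: sector_def)
    define z where "z = of_real (m * s ^ n) * cis (n * \<theta>)"
    have a: "\<bar>n * \<theta>\<bar> \<le> pi / 2 - n * \<delta>"
    proof -
      have "n * \<bar>\<theta>\<bar> \<le> n * (pi / (2 * real n) - \<delta>)" using s(2) n0 by (intro mult_left_mono) auto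
      then show ?thesis using n0 by (simp add: abs_mult right_diff_distrib)
    qed
    have "\<bar>n * \<theta>\<bar> < pi" using a nd pi_gt_zero by linarith
    from X_polar[OF s(1) this] have "X z = x" using n0 by (simp add: z_def s(3))
    have ms: "m * s ^ n > 0" using m_pos s by simp
    have nx: "cmod x = s" using s norm_rho by (simp add: norm_mult)
    have nz: "cmod z = m * s ^ n" unfolding z_def norm_mult norm_of_real using ms by simp
    have "sin (n * \<delta>) = cos (pi / 2 - n * \<delta>)" by (simp add: sin_cos_eq)
    also have "\<dots> \<le> cos \<bar>n * \<theta>\<bar>" using a nd pi_gt_zero by (intro cos_monotone_0_pi_le) linarith+
    also have "\<dots> = cos (n * \<theta>)" by (simp add: abs_if)
    finally have "sin (n * \<delta>) * (m * s ^ n) \<le> cos (n * \<theta>) * (m * s ^ n)"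
      using ms by (intro mult_right_mono) auto
    then have "Re z \<ge> sin (n * \<delta>) * cmod z" unfolding nz by (simp add: z_def mult.commute)
    with \<open>X z = x\<close> nz nx show "\<exists>z. X z = x \<and> Re z \<ge> sin (n * \<delta>) * cmod z \<and> cmod z = m * cmod x ^ n"
      by auto
  qed
qed

lemma large_radius: obtains R1 where "R1 \<ge> 1" "\<And>t. t \<ge> R1 \<Longrightarrow> m * t ^ n \<ge> R \<and> m * t ^ n \<ge> m * t"
proof
  show "max 1 (R / m) \<ge> 1" by simp
  fix t assume t: "t \<ge> max 1 (R / m)"
  have "t ^ 1 \<le> t ^ n" using t n2 by (intro power_increasing) auto
  then have *: "m * t \<le> m * t ^ n" using m_pos by simp
  moreover have "R \<le> m * t" using t m_pos by (simp add: pos_divide_le_eq mult.commute)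
  ultimately show "m * t ^ n \<ge> R \<and> m * t ^ n \<ge> m * t" by linarith
qed

lemma large_sector:
  assumes "\<not> small"
    and F: "\<And>x. (F has_field_derivative poly h x * (\<psi> x)\<^sup>2) (at x)"
    and deg: "degree h + 2 \<le> n - 1"
    and \<delta>: "\<delta> > 0"
  shows "\<exists>R K k c. k > 0 \<and> c > 0 \<and> (\<forall>x\<in>sector \<delta>. cmod x \<ge> R \<longrightarrow>
      \<psi> x \<noteq> 0 \<and> cmod (F x) \<le> K * cmod ((\<psi> x / x)\<^sup>2) \<and> cmod ((\<psi> x / x)\<^sup>2) \<ge> k * exp (c * cmod x))"
proof -
  obtain c where c: "0 < c" "c \<le> 1" and
    cone: "\<And>x. x \<in> sector \<delta> \<Longrightarrow> \<exists>z. X z = x \<and> Re z \<ge> c * cmod z \<and> cmod z = m * cmod x ^ n"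
    using sector_cone[OF \<delta>] by metis
  obtain R K k where K: "K > 0" "k > 0" and est: "\<And>z. cmod z \<ge> R \<Longrightarrow> Re z \<ge> c * cmod z \<Longrightarrow>
      \<psi> (X z) \<noteq> 0 \<and> cmod (F (X z)) \<le> K * cmod (E z) \<and> cmod (E z) \<ge> k * exp (c / 2 * cmod z)"
    using large_bound[OF assms(1) F deg c] by metis
  obtain R1 where R1: "R1 \<ge> 1" "\<And>t. t \<ge> R1 \<Longrightarrow> m * t ^ n \<ge> R \<and> m * t ^ n \<ge> m * t"
    using large_radius by metis
  show ?thesis
  proof (rule exI[of _ R1], rule exI[of _ K], rule exI[of _ k], rule exI[of _ "c / 2 * m"], intro conjI ballI impI)
    fix x assume "x \<in> sector \<delta>" "cmod x \<ge> R1"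
    with cone R1 obtain z where z: "X z = x" "Re z \<ge> c * cmod z" "cmod z \<ge> R" "cmod z \<ge> m * cmod x" by metis
    note e = est[OF z(3,2), unfolded z(1) E_def]
    show "\<psi> x \<noteq> 0" "cmod (F x) \<le> K * cmod ((\<psi> x / x)\<^sup>2)" using e by auto
    have "c / 2 * m * cmod x \<le> c / 2 * cmod z" using z(4) c by (simp add: mult.assoc)
    then have "k * exp (c / 2 * m * cmod x) \<le> k * exp (c / 2 * cmod z)" using K by simp
    then show "k * exp (c / 2 * m * cmod x) \<le> cmod ((\<psi> x / x)\<^sup>2)" using e by linarith
  qed (use K c m_pos in auto)
qed

lemma small_sector:
  assumes "small"
    and F: "\<And>x. (F has_field_derivative poly h x * (\<psi> x)\<^sup>2) (at x)"
    and deg: "degree h + 2 \<le> n - 1"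
  shows "\<exists>L. \<forall>\<delta>>0. \<exists>R K k c. K > 0 \<and> k > 0 \<and> c > 0 \<and> (\<forall>x\<in>sector \<delta>. cmod x \<ge> R \<longrightarrow>
      \<psi> x \<noteq> 0 \<and> cmod (F x - L) \<le> K * cmod ((\<psi> x / x)\<^sup>2) \<and> cmod ((\<psi> x / x)\<^sup>2) \<le> k * exp (- (c * cmod x)))"
proof -
  obtain L where L: "\<And>c. 0 < c \<Longrightarrow> c \<le> 1 \<Longrightarrow> (\<exists>R K k. K > 0 \<and> k > 0 \<and> (\<forall>z. cmod z \<ge> R \<longrightarrow> Re z \<ge> c * cmod z \<longrightarrow>
      \<psi> (X z) \<noteq> 0 \<and> cmod (F (X z) - L) \<le> K * cmod (E z) \<and> cmod (E z) \<le> k * exp (- (c / 2 * cmod z))))"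
    using small_bound[OF assms] by blast
  show ?thesis
  proof (rule exI[of _ L], intro allI impI)
    fix \<delta> :: real assume \<delta>: "\<delta> > 0"
    obtain c where c: "0 < c" "c \<le> 1" and
      cone: "\<And>x. x \<in> sector \<delta> \<Longrightarrow> \<exists>z. X z = x \<and> Re z \<ge> c * cmod z \<and> cmod z = m * cmod x ^ n"
      using sector_cone[OF \<delta>] by metis
    obtain R K k where K: "K > 0" "k > 0" and est: "\<And>z. cmod z \<ge> R \<Longrightarrow> Re z \<ge> c * cmod z \<Longrightarrow>
      \<psi> (X z) \<noteq> 0 \<and> cmod (F (X z) - L) \<le> K * cmod (E z) \<and> cmod (E z) \<le> k * exp (- (c / 2 * cmod z))"
      using L[OF c] by blast
    obtain R1 where R1: "R1 \<ge> 1" "\<And>t. t \<ge> R1 \<Longrightarrow> m * t ^ n \<ge> R \<and> m * t ^ n \<ge> m * t"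
      using large_radius by metis
    show "\<exists>R K k c. K > 0 \<and> k > 0 \<and> c > 0 \<and> (\<forall>x\<in>sector \<delta>. cmod x \<ge> R \<longrightarrow>
      \<psi> x \<noteq> 0 \<and> cmod (F x - L) \<le> K * cmod ((\<psi> x / x)\<^sup>2) \<and> cmod ((\<psi> x / x)\<^sup>2) \<le> k * exp (- (c * cmod x)))"
    proof (rule exI[of _ R1], rule exI[of _ K], rule exI[of _ k], rule exI[of _ "c / 2 * m"], intro conjI ballI impI)
      fix x assume "x \<in> sector \<delta>" "cmod x \<ge> R1"
      with cone R1 obtain z where z: "X z = x" "Re z \<ge> c * cmod z" "cmod z \<ge> R" "cmod z \<ge> m * cmod x" by metis
      note e = est[OF z(3,2), unfolded z(1) E_def]
      show "\<psi> x \<noteq> 0" "cmod (F x - L) \<le> K * cmod ((\<psi> x / x)\<^sup>2)" using e by auto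
      have "c / 2 * m * cmod x \<le> c / 2 * cmod z" using z(4) c by (simp add: mult.assoc)
      then have "k * exp (- (c / 2 * cmod z)) \<le> k * exp (- (c / 2 * m * cmod x))" using K by simp
      then show "cmod ((\<psi> x / x)\<^sup>2) \<le> k * exp (- (c / 2 * m * cmod x))" using e by linarith
    qed (use K c m_pos in auto)
  qed
qed

text \<open>The angle 2 pi / (3 n) exceeds the half opening pi / (2 n), so both boundary half-lines
  are covered with room to spare, while the argument of z stays at most 2 pi / 3, away from the cut.
  Strictness matters: at a zero of \<psi> the two sides would coincide.\<close>

lemma small_beyond_sector:
  assumes "small"
  obtains R where "R > 0" "\<And>s \<theta>. s \<ge> R \<Longrightarrow> \<bar>\<theta>\<bar> \<le> 2 * pi / (3 * real n) \<Longrightarrow> (let x = \<rho> * (of_real s * cis \<theta>) in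
      cmod (deriv \<psi> x + poly (pderiv W) x * \<psi> x) < cmod (deriv \<psi> x - poly (pderiv W) x * \<psi> x))"
proof -
  obtain R0 where R0: "R0 > 0" "\<And>z. Re z \<ge> R0 \<or> \<bar>Im z\<bar> \<ge> R0 \<Longrightarrow> cmod (A z) \<le> 1 / 2 * cmod (B z)"
    using small_region[OF assms, of "1 / 2"] by (metis half_gt_zero zero_less_one)
  obtain R2 where far: "far 1 R2" using far_exists[of 1] by auto
  obtain R1 where R1: "R1 \<ge> 1" "\<And>t. t \<ge> R1 \<Longrightarrow> m * t ^ n \<ge> max (2 * R0) R2 \<and> m * t ^ n \<ge> m * t"
    using large_radius by metis
  have n0: "real n > 0" using n2 by simp
  show thesis
  proof (rule that)
    show "R1 > 0" using R1 by simp
    fix s \<theta> :: real assume s: "s \<ge> R1" and \<theta>: "\<bar>\<theta>\<bar> \<le> 2 * pi / (3 * real n)"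
    define z where "z = of_real (m * s ^ n) * cis (n * \<theta>)"
    have a: "\<bar>n * \<theta>\<bar> \<le> 2 * pi / 3"
    proof -
      have "n * \<bar>\<theta>\<bar> \<le> n * (2 * pi / (3 * real n))" using \<theta> n0 by (intro mult_left_mono) auto
      then show ?thesis using n0 by (simp add: abs_mult)
    qed
    have s0: "s > 0" using s R1 by simp
    have "\<bar>n * \<theta>\<bar> < pi" using a pi_gt_zero by linarith
    from X_polar[OF s0 this] have Xz: "X z = \<rho> * (of_real s * cis \<theta>)" using n0 by (simp add: z_def)
    define M where "M = m * s ^ n"
    have M: "M \<ge> 2 * R0" "M \<ge> R2" "M > 0" using R1(2)[OF s] R0 by (auto simp: M_def)
    have nz: "cmod z = M" unfolding z_def norm_mult norm_of_real using M by (simp flip: M_def)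
    have cos: "cos (n * \<theta>) \<ge> - (1 / 2)"
    proof -
      have "- (1 / 2) = cos (2 * pi / 3)" using cos_120 by simp
      also have "\<dots> \<le> cos \<bar>n * \<theta>\<bar>" using a pi_gt_zero by (intro cos_monotone_0_pi_le) linarith+
      finally show ?thesis by (simp add: abs_if split: if_splits)
    qed
    \<comment> \<open>With cos at least -1/2, failure of both alternatives would bound cos^2 + sin^2
      by 1/2.\<close>
    have "cos (n * \<theta>) \<ge> 1 / 2 \<or> \<bar>sin (n * \<theta>)\<bar> \<ge> 1 / 2"
    proof (rule ccontr)
      assume *: "\<not> ?thesis"
      then have "\<bar>cos (n * \<theta>)\<bar>\<^sup>2 \<le> (1 / 2)\<^sup>2" "\<bar>sin (n * \<theta>)\<bar>\<^sup>2 \<le> (1 / 2)\<^sup>2"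
        using cos by (intro power_mono; linarith)+
      then show False using sin_cos_squared_add[of "n * \<theta>"] by (simp add: power2_eq_square)
    qed
    then have "Re z \<ge> R0 \<or> \<bar>Im z\<bar> \<ge> R0"
    proof
      assume "cos (n * \<theta>) \<ge> 1 / 2"
      then have "M * (1 / 2) \<le> M * cos (n * \<theta>)" using M by (intro mult_left_mono) auto
      then show ?thesis using M by (simp add: z_def M_def)
    next
      assume "\<bar>sin (n * \<theta>)\<bar> \<ge> 1 / 2"
      then have "M * (1 / 2) \<le> M * \<bar>sin (n * \<theta>)\<bar>" using M by (intro mult_left_mono) auto
      moreover have "\<bar>Im z\<bar> = M * \<bar>sin (n * \<theta>)\<bar>"
        using M(3) by (simp add: z_def abs_mult flip: M_def)
      ultimately have "R0 \<le> \<bar>Im z\<bar>" using M(1) by linarith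
      then show ?thesis ..
    qed
    then have AB: "cmod (A z) \<le> 1 / 2 * cmod (B z)" using R0 by blast
    moreover have "A z \<noteq> 0 \<or> B z \<noteq> 0" using far M nz by (intro AB_nonzero) (auto simp: far_def)
    ultimately have "cmod (B z) > 0" by auto
    with AB have "cmod (A z) < cmod (B z)" by linarith
    then show "let x = \<rho> * (of_real s * cis \<theta>) in
      cmod (deriv \<psi> x + poly (pderiv W) x * \<psi> x) < cmod (deriv \<psi> x - poly (pderiv W) x * \<psi> x)"
      by (simp add: A_def B_def Xz Let_def)
  qed
qed

text \<open>Taking h = 0 and F = 0 reduces the large alternative to its exponential lower bound for
  (\<psi>/x)^2, which a bounded \<psi> violates. The upper bound on \<delta> keeps the bisecting ray
  in the sector, and n >= 3 provides the degree condition 0 + 2 <= n - 1.\<close>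

lemma small_if_bounded_on_ray:
  assumes n3: "3 \<le> n" and \<delta>: "0 < \<delta>" "\<delta> \<le> pi / (2 * real n)"
    and bd: "\<And>x. x \<in> sector \<delta> \<Longrightarrow> cmod x \<ge> R \<Longrightarrow> cmod (\<psi> x) \<le> 1"
  shows "small"
proof (rule ccontr)
  assume "\<not> small"
  have F: "((\<lambda>x. 0) has_field_derivative poly 0 x * (\<psi> x)\<^sup>2) (at x)" for x by simp
  have deg0: "degree (0 :: complex poly) + 2 \<le> n - 1" using n3 by simp
  obtain R1 K k c where k: "k > 0" "c > 0" and est: "\<And>x. x \<in> sector \<delta> \<Longrightarrow> cmod x \<ge> R1 \<Longrightarrow> 
      cmod ((\<psi> x / x)\<^sup>2) \<ge> k * exp (c * cmod x)"
    using large_sector[OF \<open>\<not> small\<close> F deg0 \<delta>(1)] by blast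
  define s where "s = max (max R R1) (max 1 (1 / (k * c)))"
  define x where "x = \<rho> * (of_real s * cis 0)"
  have s: "s \<ge> R" "s \<ge> R1" "s \<ge> 1" "s \<ge> 1 / (k * c)" by (simp_all add: s_def)
  have x: "x \<in> sector \<delta>" unfolding sector_def x_def
    by (rule CollectI, rule exI[of _ s], rule exI[of _ 0]) (use \<delta> s in auto)
  have nx: "cmod x = s" using s norm_rho by (simp add: x_def norm_mult)
  have "1 \<le> k * (c * s)" using s(4) k by (simp add: pos_divide_le_eq mult_ac)
  also have "\<dots> < k * exp (c * s)" 
    using k exp_ge_add_one_self[of "c * s"] by (intro mult_strict_left_mono; linarith)
  also have "\<dots> \<le> cmod ((\<psi> x / x)\<^sup>2)" using est[OF x] nx s by simp
  also have "\<dots> = (cmod (\<psi> x) / s)\<^sup>2" by (simp add: norm_power norm_divide nx)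
  also have "\<dots> \<le> 1\<^sup>2"
  proof (rule power_mono)
    have "cmod (\<psi> x) \<le> s" using bd[OF x] nx s by simp
    then show "cmod (\<psi> x) / s \<le> 1" using s by simp
  qed (use s in auto)
  finally show False by simp
qed

end

section \<open>Integrals from infinity and along paths\<close>

text \<open>An interval containing a large ball meets the half-line in [0, b] with b large, so
  convergence of the proper integrals is enough for the gauge integral; absolute convergence does
  not enter.\<close>

lemma improper_has_integral:
  fixes f :: "real \<Rightarrow> 'a::banach"
  assumes cont: "continuous_on UNIV f" and lim: "((\<lambda>y. integral {0..y} f) \<longlongrightarrow> l) at_top"
  shows "(f has_integral l) {0..}"
proof -
  have nb: "\<not> (\<exists>a b. {0::real..} = cbox a b)"
  proof
    assume "\<exists>a b. {0::real..} = cbox a b"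
    then obtain a b :: real where ab: "{0..} = {a..b}" unfolding cbox_interval by blast
    have "max 0 (b + 1) \<in> {0..}" by simp
    then have "max 0 (b + 1) \<in> {a..b}" unfolding ab .
    then show False by simp
  qed
  show ?thesis
  proof (subst has_integral_alt, subst if_not_P[OF nb], intro allI impI)
    fix e :: real assume "e > 0"
    with lim have "\<forall>\<^sub>F y in at_top. dist (integral {0..y} f) l < e" by (rule tendstoD)
    then obtain B0 where B0: "\<And>y. y \<ge> B0 \<Longrightarrow> dist (integral {0..y} f) l < e"
      unfolding eventually_at_top_linorder by blast
    define B where "B = max B0 1"
    show "\<exists>B>0. \<forall>a b. ball 0 B \<subseteq> cbox a b \<longrightarrow>
        (\<exists>z. ((\<lambda>x. if x \<in> {0..} then f x else 0) has_integral z) (cbox a b) \<and> norm (z - l) < e)"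
    proof (intro exI[of _ B] conjI allI impI)
      show "B > 0" by (simp add: B_def)
      fix a b :: real assume sub: "ball 0 B \<subseteq> cbox a b"
      have B1: "B \<ge> 1" "B \<ge> B0" by (simp_all add: B_def)
      have "0 \<in> ball 0 B" using B1 by simp
      with sub have "0 \<in> cbox a b" by blast
      then have ab: "a \<le> 0" "0 \<le> b" by auto
      have "B \<le> b"
      proof (rule ccontr)
        assume "\<not> B \<le> b"
        then have "(b + B) / 2 \<in> ball 0 B" using ab by (simp add: dist_real_def)
        with sub have "(b + B) / 2 \<in> cbox a b" by blast
        with \<open>\<not> B \<le> b\<close> show False by (simp add: field_simps)
      qed
      have "(f has_integral integral {0..b} f) {0..b}"
        using cont by (intro integrable_integral integrable_continuous_interval) (rule continuous_on_subset, auto)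
      then have "((\<lambda>x. if x \<in> {0..b} then f x else 0) has_integral integral {0..b} f) {a..b}"
        by (subst has_integral_restrict) (use ab in auto)
      moreover have "(if x \<in> {0..b} then f x else 0) = (if x \<in> {0..} then f x else 0)" if "x \<in> {a..b}" for x
        using that by auto
      ultimately have "((\<lambda>x. if x \<in> {0..} then f x else 0) has_integral integral {0..b} f) (cbox a b)"
        unfolding cbox_interval by (rule has_integral_eq[rotated]) auto
      moreover have "norm (integral {0..b} f - l) < e" using B0[of b] \<open>B \<le> b\<close> B1 by (simp add: dist_norm)
      ultimately show "\<exists>z. ((\<lambda>x. if x \<in> {0..} then f x else 0) has_integral z) (cbox a b) \<and> norm (z - l) < e"
        by blast
    qed
  qed
qed

lemma int_from_inf0_eq:
  assumes P: "\<And>x. (P has_field_derivative f x) (at x)"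
    and cont: "continuous_on UNIV f"
    and lim: "((\<lambda>s. P (of_real s * cis (- Arg (lead_coeff (pderiv V)) / real (d + 1)))) \<longlongrightarrow> L) at_top"
  shows "int_from_inf0 V d f x = P x - L"
proof -
  define \<phi> where "\<phi> = - Arg (lead_coeff (pderiv V)) / real (d + 1)"
  have seg: "((\<lambda>t::real. f (of_real t * u) * u) has_integral (P (of_real b * u) - P 0)) {0..b}" if "b \<ge> 0" for u b
  proof -
    have "((\<lambda>t::real. P (of_real t * u)) has_vector_derivative f (of_real t * u) * u) (at t within {0..b})" for t
    proof -
      have "((\<lambda>t. of_real t * u) has_vector_derivative u) (at t)" by (auto intro!: derivative_eq_intros)
      from field_vector_diff_chain_at[OF this P] show ?thesis
        by (simp add: o_def mult.commute has_vector_derivative_at_within)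
    qed
    from fundamental_theorem_of_calculus[OF that this] show ?thesis by simp
  qed
  have "((\<lambda>r::real. f (of_real r * cis \<phi>) * cis \<phi>) has_integral (L - P 0)) {0..}"
  proof (rule improper_has_integral)
    show "continuous_on UNIV (\<lambda>r::real. f (of_real r * cis \<phi>) * cis \<phi>)"
      by (intro continuous_intros continuous_on_compose2[OF cont]) auto
    have "((\<lambda>y. P (of_real y * cis \<phi>) - P 0) \<longlongrightarrow> L - P 0) at_top"
      using lim unfolding \<phi>_def by (intro tendsto_intros)
    moreover have "\<forall>\<^sub>F y in at_top. P (of_real y * cis \<phi>) - P 0 = integral {0..y} (\<lambda>r::real. f (of_real r * cis \<phi>) * cis \<phi>)"
      using eventually_ge_at_top[of 0] by eventually_elim (rule integral_unique[OF seg, symmetric])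
    ultimately show "((\<lambda>y. integral {0..y} (\<lambda>r::real. f (of_real r * cis \<phi>) * cis \<phi>)) \<longlongrightarrow> L - P 0) at_top"
      by (rule Lim_transform_eventually)
  qed
  moreover have "((\<lambda>t::real. f (of_real t * x) * x) has_integral (P x - P 0)) {0..1}" using seg[of 1 x] by simp
  ultimately show ?thesis unfolding int_from_inf0_def Let_def \<phi>_def[symmetric]
    by (simp only: integral_unique) simp
qed

text \<open>The finitely many points where the path fails to be C1 do no harm, because the primitive
  along the path remains continuous there.\<close>

lemma path_integral_is_primitive:
  assumes \<gamma>: "\<gamma> piecewise_C1_differentiable_on UNIV"
    and P: "\<And>x. (P has_field_derivative f x) (at x)"
    and int: "path_integral_is \<gamma> f c"
    and lims: "((\<lambda>t. P (\<gamma> t)) \<longlongrightarrow> l) at_bot" "((\<lambda>t. P (\<gamma> t)) \<longlongrightarrow> l') at_top"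
  shows "c = l' - l"
proof -
  obtain S where S: "finite S" "\<gamma> C1_differentiable_on (UNIV - S)" and cont: "continuous_on UNIV \<gamma>"
    using \<gamma> by (auto simp: piecewise_C1_differentiable_on_def)
  have der: "((\<lambda>t. P (\<gamma> t)) has_vector_derivative f (\<gamma> t) * vector_derivative \<gamma> (at t)) (at t)" if "t \<notin> S" for t
  proof -
    have "\<gamma> differentiable at t" using S that by (auto simp: C1_differentiable_on_eq)
    then have "(\<gamma> has_vector_derivative vector_derivative \<gamma> (at t)) (at t)"
      by (simp add: vector_derivative_works)
    from field_vector_diff_chain_at[OF this P] show ?thesis by (simp add: o_def mult.commute)
  qed
  have contP: "continuous_on UNIV (\<lambda>t. P (\<gamma> t))"
    by (intro continuous_on_compose2[OF _ cont, of UNIV P]) (auto intro!: DERIV_continuous_on P)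
  have seg: "((\<lambda>t. f (\<gamma> t) * vector_derivative \<gamma> (at t)) has_integral (P (\<gamma> T) - P (\<gamma> (- T)))) {-T..T}"
    if "T \<ge> 0" for T
    using that S(1) der by (intro fundamental_theorem_of_calculus_interior_strong[of S])
      (auto intro: continuous_on_subset[OF contP])
  \<comment> \<open>Integrability over the whole line controls all intervals containing a large
    ball, in particular the symmetric ones [-T, T].\<close>
  have "((\<lambda>T. P (\<gamma> T) - P (\<gamma> (- T))) \<longlongrightarrow> c) at_top"
  proof (rule tendstoI)
    fix e :: real assume "e > 0"
    have nb: "\<not> (\<exists>a b. (UNIV::real set) = cbox a b)" by (metis UNIV_I bounded_cbox not_bounded_UNIV)
    obtain B where B: "B > 0" "\<forall>a b. ball 0 B \<subseteq> cbox a b \<longrightarrow>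
        (\<exists>z. ((\<lambda>t. if t \<in> UNIV then f (\<gamma> t) * vector_derivative \<gamma> (at t) else 0) has_integral z) (cbox a b) \<and> norm (z - c) < e)"
      using has_integral_altD[OF int[unfolded path_integral_is_def] nb \<open>e > 0\<close>] by blast
    show "\<forall>\<^sub>F T in at_top. dist (P (\<gamma> T) - P (\<gamma> (- T))) c < e"
      using eventually_ge_at_top[of B]
    proof eventually_elim
      case (elim T)
      then have "ball 0 B \<subseteq> cbox (- T) T" by (auto simp: dist_real_def)
      from B(2)[rule_format, OF this] obtain z where
        z: "((\<lambda>t. f (\<gamma> t) * vector_derivative \<gamma> (at t)) has_integral z) (cbox (-T) T)" "norm (z - c) < e"
        by (simp only: UNIV_I if_True) blast
      have "z = P (\<gamma> T) - P (\<gamma> (- T))"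
        using has_integral_unique[OF z(1)[unfolded cbox_interval] seg] elim B by simp
      with z show ?case by (simp add: dist_norm)
    qed
  qed
  moreover have "((\<lambda>T. P (\<gamma> T) - P (\<gamma> (- T))) \<longlongrightarrow> l' - l) at_top"
    by (intro tendsto_diff lims filterlim_compose[OF lims(1) filterlim_uminus_at_bot_at_top])
  ultimately show ?thesis by (rule tendsto_unique[rotated]) simp
qed

section \<open>Geometry of the Stokes sectors\<close>

lemma eventually_sector_filter:
  "eventually P (sector_filter V d j \<delta>) \<longleftrightarrow> (\<exists>R. \<forall>x\<in>closed_subsector V d j \<delta>. cmod x \<ge> R \<longrightarrow> P x)"
  unfolding sector_filter_def eventually_inf_principal eventually_at_infinity by auto

lemma ends_in_filterlim:
  assumes "ends_in V d j \<gamma> G"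
  obtains \<delta> where "\<delta> > 0" "filterlim \<gamma> (sector_filter V d j \<delta>) G"
proof -
  obtain \<delta> where \<delta>: "\<delta> > 0" "eventually (\<lambda>t. \<gamma> t \<in> closed_subsector V d j \<delta>) G"
    and inf: "filterlim (\<lambda>t. norm (\<gamma> t)) at_top G"
    using assms by (auto simp: ends_in_def)
  have "filterlim \<gamma> at_infinity G" using inf filterlim_norm_at_top_imp_at_infinity by blast
  with \<delta> have "filterlim \<gamma> (sector_filter V d j \<delta>) G"
    unfolding sector_filter_def by (simp add: filterlim_inf filterlim_principal)
  with \<delta> that show thesis by blast
qed

text \<open>The bisector of S_j, half an opening below L_j. The index is not reduced, so advancing
  it by 2 d + 2 adds a full turn to the angle.\<close>

definition sector_center :: "complex poly \<Rightarrow> nat \<Rightarrow> nat \<Rightarrow> real" where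
  "sector_center V d j = - Arg (lead_coeff (pderiv V)) / real (d + 1) + pi * real j / real (d + 1)"

lemma half_sector: "pi / real (d + 1) = 2 * (pi / (2 * real (d + 1)))"
proof -
  have "x / y = 2 * (x / (2 * y))" for x y :: real by simp
  then show ?thesis .
qed

lemma stokes_angle_eq: "stokes_angle V d j = sector_center V d j + pi / (2 * real (d + 1))"
proof -
  have "a / N + p * (j + 1 / 2) / N = (a / N + p * j / N) + p / (2 * N)" for a p j N :: real
    by (simp add: distrib_left add_divide_distrib)
  then show ?thesis unfolding stokes_angle_def sector_center_def .
qed

lemma sector_center_Suc: "sector_center V d (Suc j) = sector_center V d j + pi / real (d + 1)"
proof -
  have "a / N + p * (1 + j) / N = (a / N + p * j / N) + p / N" for a p j N :: real
    by (simp add: distrib_left add_divide_distrib)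
  then show ?thesis unfolding sector_center_def of_nat_Suc .
qed

lemma closed_subsector_eq:
  "closed_subsector V d j \<delta> = {x. \<exists>s \<theta>. s > 0 \<and> \<bar>\<theta>\<bar> \<le> pi / (2 * real (d + 1)) - \<delta> \<and>
      x = cis (sector_center V d j) * (of_real s * cis \<theta>)}" (is "_ = ?R")
proof (intro set_eqI iffI)
  fix x assume "x \<in> closed_subsector V d j \<delta>"
  then obtain s \<phi> where s: "s > 0" "stokes_angle V d j - pi / real (d + 1) + \<delta> \<le> \<phi>"
    "\<phi> \<le> stokes_angle V d j - \<delta>" "x = of_real s * cis \<phi>" unfolding closed_subsector_def by blast
  define q where "q = pi / (2 * real (d + 1))"
  note angle = stokes_angle_eq[of V d j, folded q_def] half_sector[of d, folded q_def]
  have "\<bar>\<phi> - sector_center V d j\<bar> \<le> pi / (2 * real (d + 1)) - \<delta>"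
    using s(2,3) unfolding angle q_def[symmetric] by linarith
  moreover have "x = cis (sector_center V d j) * (of_real s * cis (\<phi> - sector_center V d j))"
    by (simp add: s(4) cis_mult mult.left_commute)
  ultimately show "x \<in> ?R" using s(1) by blast
next
  fix x assume "x \<in> ?R"
  then obtain s \<theta> where s: "s > 0" "\<bar>\<theta>\<bar> \<le> pi / (2 * real (d + 1)) - \<delta>"
    "x = cis (sector_center V d j) * (of_real s * cis \<theta>)" by blast
  define q where "q = pi / (2 * real (d + 1))"
  note angle = stokes_angle_eq[of V d j, folded q_def] half_sector[of d, folded q_def]
  have "stokes_angle V d j - pi / real (d + 1) + \<delta> \<le> sector_center V d j + \<theta>"
    "sector_center V d j + \<theta> \<le> stokes_angle V d j - \<delta>"
    using s(2) unfolding angle q_def[symmetric] by linarith+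
  moreover have "x = of_real s * cis (sector_center V d j + \<theta>)"
    by (simp add: s(3) cis_mult[symmetric] mult_ac)
  ultimately show "x \<in> closed_subsector V d j \<delta>" using s(1) unfolding closed_subsector_def by blast
qed

lemma sector_bigo_quotient:
  assumes \<h>: "\<h> \<noteq> 0"
    and bound: "\<And>\<delta>. \<delta> > 0 \<Longrightarrow> \<exists>R K. \<forall>x\<in>closed_subsector V d j \<delta>. cmod x \<ge> R \<longrightarrow>
      \<psi> x \<noteq> 0 \<and> cmod (G x) \<le> K * cmod ((\<psi> x / x)\<^sup>2)"
  shows "sector_bigo V d j (\<lambda>x. G x / (\<h> * \<psi> x ^ 2)) (\<lambda>x. 1 / x ^ 2)"
  unfolding sector_bigo_def
proof (intro allI impI)
  fix \<delta> :: real assume "\<delta> > 0"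
  from bound[OF this] obtain R K where RK: "\<And>x. x\<in>closed_subsector V d j \<delta> \<Longrightarrow> cmod x \<ge> R \<Longrightarrow>
      \<psi> x \<noteq> 0 \<and> cmod (G x) \<le> K * cmod ((\<psi> x / x)\<^sup>2)" by blast
  show "(\<lambda>x. G x / (\<h> * \<psi> x ^ 2)) \<in> O[sector_filter V d j \<delta>](\<lambda>x. 1 / x ^ 2)"
  proof (rule bigoI[where c="K / cmod \<h>"], unfold eventually_sector_filter, intro exI[of _ R] ballI impI)
    fix x assume "x \<in> closed_subsector V d j \<delta>" "R \<le> cmod x"
    from RK[OF this] have x: "\<psi> x \<noteq> 0" "cmod (G x) \<le> K * cmod ((\<psi> x / x)\<^sup>2)" by auto
    have "cmod (G x / (\<h> * \<psi> x ^ 2)) = cmod (G x) / (cmod \<h> * cmod (\<psi> x) ^ 2)"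
      by (simp add: norm_divide norm_mult norm_power)
    also have "\<dots> \<le> K * cmod ((\<psi> x / x)\<^sup>2) / (cmod \<h> * cmod (\<psi> x) ^ 2)"
      using x by (intro divide_right_mono) auto
    also have "\<dots> = K / cmod \<h> * cmod (1 / x ^ 2)"
      using x \<h> by (simp add: norm_divide norm_power power_divide)
    finally show "norm (G x / (\<h> * \<psi> x ^ 2)) \<le> K / cmod \<h> * norm (1 / x ^ 2)" .
  qed
qed

section \<open>Counting small sectors\<close>

lemma entire_zeros_bounded_finite:
  assumes "\<psi> holomorphic_on UNIV" "\<exists>x. \<psi> x \<noteq> 0"
  shows "finite {x. cmod x \<le> R \<and> \<psi> x = 0}"
proof (cases "\<psi> constant_on UNIV")
  case True
  then obtain c where "\<And>x. \<psi> x = c" by (auto simp: constant_on_def)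
  with assms(2) show ?thesis by auto
next
  case False
  from holomorphic_compact_finite_zeros[OF assms(1) open_UNIV connected_UNIV compact_cball subset_UNIV False, of 0 R]
  show ?thesis by (simp add: Collect_conj_eq Int_commute cball_def)
qed

section \<open>Positivity of \<h>\<close>

lemma power_times_exp_tendsto_0:
  fixes c :: real
  assumes "c > 0"
  shows "((\<lambda>s. s ^ N * exp (- (c * s))) \<longlongrightarrow> 0) at_top"
proof -
  have "filterlim (\<lambda>s. c * s) at_top at_top"
    using assms by (intro filterlim_tendsto_pos_mult_at_top[OF tendsto_const _ filterlim_ident]) auto
  from filterlim_compose[OF tendsto_power_div_exp_0 this]
  have "((\<lambda>s. (c * s) ^ N / exp (c * s) / c ^ N) \<longlongrightarrow> 0 / c ^ N) at_top"
    by (intro tendsto_divide tendsto_const) (use assms in auto)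
  moreover have "(c * s) ^ N / exp (c * s) / c ^ N = s ^ N * exp (- (c * s))" for s
    using assms by (simp add: power_mult_distrib exp_minus field_simps)
  ultimately show ?thesis by simp
qed

text \<open>On the ray at angle \<theta>/n from the bisector of S_0 the leading term of V/(2 \<h>)
  is a positive multiple of cis \<theta> / \<h>. Were its real part negative, exp (V/(2 \<h>)) would
  have modulus below 1 far out, and the decay of \<psi> would make their product exponentially
  small, against the lower power bound in \<open>physical\<close>.\<close>

lemma poly_over_hbar_nonneg:
  fixes V :: "complex poly" and \<h> :: complex
  assumes \<h>: "\<h> \<noteq> 0" and deg: "degree V = d + 1"
    and hol: "\<psi> holomorphic_on UNIV" and nz: "\<exists>x. \<psi> x \<noteq> 0"
    and dec: "exp_small V d \<psi> 0" and phys: "physical V d \<h> \<psi> 0"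
    and \<theta>: "\<bar>\<theta>\<bar> < pi / 2"
  shows "Re (cis \<theta> / \<h>) \<ge> 0"
proof (rule ccontr)
  assume neg: "\<not> Re (cis \<theta> / \<h>) \<ge> 0"
  define n where "n = d + 1"
  have n0: "real n > 0" by (simp add: n_def)
  define \<phi> where "\<phi> = sector_center V d 0 + \<theta> / n"
  \<comment> \<open>Chosen so that the ray is an edge of the closed subsector: |\<theta>|/n = pi/(2
    n) - \<delta>.\<close>
  define \<delta> where "\<delta> = (pi / 2 - \<bar>\<theta>\<bar>) / n"
  have \<delta>: "\<delta> > 0" using \<theta> n0 by (simp add: \<delta>_def)
  define x where "x = (\<lambda>s::real. of_real s * cis \<phi>)"
  have in_sector: "x s \<in> closed_subsector V d 0 \<delta>" if "s > 0" for s
  proof -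
    have "pi / (2 * real (d + 1)) - \<delta> = \<bar>\<theta> / n\<bar>"
      unfolding \<delta>_def n_def[symmetric] using n0 by (simp add: diff_divide_distrib)
    moreover have "x s = cis (sector_center V d 0) * (of_real s * cis (\<theta> / n))"
      by (simp add: x_def \<phi>_def mult_ac flip: cis_mult)
    ultimately show ?thesis unfolding closed_subsector_eq using that
      by (intro CollectI exI[of _ s] exI[of _ "\<theta> / n"] conjI) simp_all
  qed
  have nx: "cmod (x s) = s" if "s > 0" for s using that by (simp add: x_def norm_mult)
  obtain c where c: "c > 0" "eventually (\<lambda>x. norm (\<psi> x) \<le> exp (- c * norm x)) (sector_filter V d 0 \<delta>)"
    using dec \<delta> unfolding exp_small_def by blast
  obtain N where N: "(\<lambda>x. 1 / (\<psi> x * exp (poly V x / (2 * \<h>)))) \<in> O[sector_filter V d 0 \<delta>](\<lambda>x. x ^ N)"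
    using phys \<delta> unfolding physical_def by blast
  from landau_o.bigE[OF N] obtain C where C: "C > 0"
    "eventually (\<lambda>x. norm (1 / (\<psi> x * exp (poly V x / (2 * \<h>)))) \<le> C * norm (x ^ N)) (sector_filter V d 0 \<delta>)" by blast
  obtain R1 where R1: "\<And>y. y \<in> closed_subsector V d 0 \<delta> \<Longrightarrow> cmod y \<ge> R1 \<Longrightarrow> norm (\<psi> y) \<le> exp (- c * norm y)"
    using c(2) unfolding eventually_sector_filter by blast
  obtain R2 where R2: "\<And>y. y \<in> closed_subsector V d 0 \<delta> \<Longrightarrow> cmod y \<ge> R2 \<Longrightarrow>
      norm (1 / (\<psi> y * exp (poly V y / (2 * \<h>)))) \<le> C * norm (y ^ N)"
    using C(2) unfolding eventually_sector_filter by blast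
  have "((\<lambda>s. C * (s ^ N * exp (- (c * s)))) \<longlongrightarrow> C * 0) at_top"
    by (intro tendsto_mult tendsto_const power_times_exp_tendsto_0 c)
  then have ev1: "\<forall>\<^sub>F s in at_top. C * (s ^ N * exp (- (c * s))) < 1"
    by (rule order_tendstoD(2)) simp
  have ev2: "\<forall>\<^sub>F s in at_top. Re (poly V (x s) / (2 * \<h>)) < 0"
  proof -
    have xinf: "filterlim x at_infinity at_top"
      unfolding filterlim_at_infinity[OF order_refl]
    proof (intro allI impI)
      fix r :: real assume "r > 0"
      show "\<forall>\<^sub>F s in at_top. r \<le> cmod (x s)"
        using eventually_ge_at_top[of r] by eventually_elim (use \<open>r > 0\<close> nx in auto)
    qed
    have lc: "lead_coeff (pderiv V) = of_nat n * lead_coeff V"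
      by (simp add: degree_pderiv deg coeff_pderiv n_def)
    have l0: "lead_coeff V \<noteq> 0" using deg by (intro leading_coeff_neq_0) auto
    have V1: "lead_coeff V * cis \<phi> ^ n = of_real (cmod (lead_coeff V)) * cis \<theta>"
    proof -
      have "Arg (lead_coeff (pderiv V)) = Arg (lead_coeff V)"
        unfolding lc using Arg_times_of_real[of n "lead_coeff V"] n0 by simp
      then have "n * \<phi> = - Arg (lead_coeff V) + \<theta>"
        using n0 unfolding \<phi>_def sector_center_def n_def[symmetric] by (simp add: distrib_left right_diff_distrib)
      then have "cis \<phi> ^ n = cis (- Arg (lead_coeff V)) * cis \<theta>"
        by (simp only: Complex.DeMoivre cis_mult)
      moreover have "lead_coeff V = of_real (cmod (lead_coeff V)) * cis (Arg (lead_coeff V))"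
        using Arg_eq[OF l0] by (simp add: cis_conv_exp)
      moreover have "l * q = k * (a * b) * t" if "q = b * t" "l = k * a" for l q k a b t :: complex
        using that by simp
      ultimately have "lead_coeff V * cis \<phi> ^ n = of_real (cmod (lead_coeff V)) *
          (cis (Arg (lead_coeff V)) * cis (- Arg (lead_coeff V))) * cis \<theta>"
        by blast
      then show ?thesis by (simp add: cis_mult)
    qed
    have "((\<lambda>s. poly V (x s) / x s ^ n) \<longlongrightarrow> lead_coeff V) at_top"
      using filterlim_compose[OF poly_divide_tendsto_aux[of V] xinf] by (simp add: deg n_def)
    then have "((\<lambda>s. Re (poly V (x s) / x s ^ n * (cis \<phi> ^ n / (2 * \<h>)))) \<longlongrightarrow> Re (lead_coeff V * (cis \<phi> ^ n / (2 * \<h>)))) at_top"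
      by (intro tendsto_intros)
    moreover have "Re (lead_coeff V * (cis \<phi> ^ n / (2 * \<h>))) < 0"
    proof -
      have "lead_coeff V * (cis \<phi> ^ n / (2 * \<h>)) = of_real (cmod (lead_coeff V) / 2) * (cis \<theta> / \<h>)"
        using V1 by (simp add: field_simps)
      then have "Re (lead_coeff V * (cis \<phi> ^ n / (2 * \<h>))) = cmod (lead_coeff V) / 2 * Re (cis \<theta> / \<h>)"
        by (simp only: Re_complex_of_real Im_complex_of_real times_complex.sel)
      also have "\<dots> < 0" using neg l0 by (intro mult_pos_neg) auto
      finally show ?thesis .
    qed
    ultimately have "\<forall>\<^sub>F s in at_top. Re (poly V (x s) / x s ^ n * (cis \<phi> ^ n / (2 * \<h>))) < 0"
      by (rule order_tendstoD(2))
    then show ?thesis using eventually_gt_at_top[of 0]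
    proof eventually_elim
      case (elim s)
      have "poly V (x s) / x s ^ n * (cis \<phi> ^ n / (2 * \<h>)) = of_real (1 / s ^ n) * (poly V (x s) / (2 * \<h>))"
        using elim by (simp add: x_def power_mult_distrib)
      then have "Re (poly V (x s) / x s ^ n * (cis \<phi> ^ n / (2 * \<h>))) = 1 / s ^ n * Re (poly V (x s) / (2 * \<h>))"
        by (simp only: Re_complex_of_real Im_complex_of_real times_complex.sel)
      with elim(1) have "1 / s ^ n * Re (poly V (x s) / (2 * \<h>)) < 0" by (simp only:)
      moreover have "1 / s ^ n > 0" using elim by simp
      ultimately show ?case by (metis mult_nonneg_nonneg less_imp_le not_le)
    qed
  qed
  have "\<forall>\<^sub>F s in at_top. \<psi> (x s) = 0"
    using ev1 ev2 eventually_gt_at_top[of 0] eventually_ge_at_top[of R1] eventually_ge_at_top[of R2]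
  proof eventually_elim
    case (elim s)
    show ?case
    proof (rule ccontr)
      \<comment> \<open>At a zero of \<psi> the inverse in \<open>physical\<close> takes the default
        value 0 and its bound is vacuous. The estimate therefore only yields that \<psi> vanishes
        far out on the ray, which finiteness of the zeros in a disc then refutes.\<close>
      assume p: "\<psi> (x s) \<noteq> 0"
      define u where "u = cmod (exp (poly V (x s) / (2 * \<h>)))"
      have u: "0 < u" "u < 1" using elim by (auto simp: u_def)
      have a: "cmod (\<psi> (x s)) \<le> exp (- (c * s))" using R1[OF in_sector] nx elim by simp
      have "1 / (cmod (\<psi> (x s)) * u) \<le> C * s ^ N"
        using R2[OF in_sector[of s]] nx[of s] elim by (simp add: norm_divide norm_mult norm_power u_def)
      then have "1 \<le> C * s ^ N * (cmod (\<psi> (x s)) * u)" using p u by (simp add: pos_divide_le_eq)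
      also have "\<dots> \<le> C * s ^ N * (exp (- (c * s)) * 1)"
        using a u C elim by (intro mult_left_mono mult_mono) auto
      also have "\<dots> < 1" using elim by (simp add: mult.assoc)
      finally show False by simp
    qed
  qed
  then obtain R where R: "\<And>s. s \<ge> R \<Longrightarrow> \<psi> (x s) = 0" unfolding eventually_at_top_linorder by blast
  define R' where "R' = max R 1"
  have "x ` {R'..R'+1} \<subseteq> {y. cmod y \<le> R' + 1 \<and> \<psi> y = 0}"
    using R nx by (auto simp: R'_def)
  moreover have "inj_on x {R'..R'+1}" by (auto simp: inj_on_def x_def)
  ultimately have "finite {R'..R'+1}"
    using entire_zeros_bounded_finite[OF hol nz] by (metis finite_imageD finite_subset)
  then show False using infinite_Icc[of R' "R' + 1"] by simp
qed

text \<open>The half planes cut out by all these \<theta> intersect in the nonnegative real axis,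
  and 1/\<h> lies in each of them.\<close>

lemma positive_real_if_half_plane:
  fixes \<h> :: complex
  assumes "\<h> \<noteq> 0" and half: "\<And>\<theta>. \<bar>\<theta>\<bar> < pi / 2 \<Longrightarrow> Re (cis \<theta> / \<h>) \<ge> 0"
  obtains H where "H > 0" "\<h> = of_real H"
proof -
  define u v where "u = Re (1 / \<h>)" and "v = Im (1 / \<h>)"
  have uv: "u * cos \<theta> - v * sin \<theta> \<ge> 0" if "\<bar>\<theta>\<bar> < pi / 2" for \<theta>
  proof -
    have "cis \<theta> / \<h> = cis \<theta> * (1 / \<h>)" by simp
    then have "Re (cis \<theta> / \<h>) = u * cos \<theta> - v * sin \<theta>"
      by (simp only: times_complex.sel cis.sel u_def v_def) (simp add: mult.commute)
    with half[OF that] show ?thesis by simp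
  qed
  have u0: "u \<ge> 0" using uv[of 0] by simp
  have "v = 0"
  proof (rule ccontr)
    assume v: "v \<noteq> 0"
    \<comment> \<open>With this tangent, u cos \<theta> - v sin \<theta> equals -|v| cos \<theta>,
      which is negative.\<close>
    define \<theta> where "\<theta> = arctan ((u + \<bar>v\<bar>) / v)"
    have b: "\<bar>\<theta>\<bar> < pi / 2" using arctan_bounded[of "(u + \<bar>v\<bar>) / v"] by (auto simp: \<theta>_def)
    have cos: "cos \<theta> > 0" using b by (intro cos_gt_zero_pi) auto
    have "tan \<theta> = (u + \<bar>v\<bar>) / v" by (simp add: \<theta>_def tan_arctan)
    then have "v * sin \<theta> = (u + \<bar>v\<bar>) * cos \<theta>" using v cos by (simp add: tan_def field_simps)
    with uv[OF b] have "\<bar>v\<bar> * cos \<theta> \<le> 0" by (simp add: algebra_simps)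
    then show False using v cos by (simp add: mult_le_0_iff)
  qed
  then have inv: "1 / \<h> = of_real u" by (simp add: complex_eq_iff u_def v_def)
  then have "u \<noteq> 0" using assms(1) by auto
  with u0 have "u > 0" by simp
  moreover have "\<h> = of_real (1 / u)" using inv assms(1) \<open>u \<noteq> 0\<close> by (simp add: field_simps)
  ultimately show thesis using that[of "1 / u"] by simp
qed

text \<open>With L_j separating S_j from S_(j+1), each small sector blocks its two bordering
  half-lines, and none is blocked twice because small sectors are never adjacent.\<close>

lemma card_no_adjacent:
  fixes S Acc :: "nat \<Rightarrow> bool"
  assumes wrap: "S N = S 0" and N: "N > 0"
    and adj: "\<And>j. S j \<Longrightarrow> \<not> S (Suc j)"
    and acc: "\<And>j. S j \<Longrightarrow> \<not> Acc j" "\<And>j. S (Suc j) \<Longrightarrow> \<not> Acc j"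
  shows "card {j. j < N \<and> Acc j} + 2 * card {j. j < N \<and> S j} \<le> N"
proof -
  define T T' A where "T = {j. j < N \<and> S j}" and "T' = {j. j < N \<and> S (Suc j)}" and "A = {j. j < N \<and> Acc j}"
  have fin: "finite T" "finite T'" "finite A" by (simp_all add: T_def T'_def A_def)
  \<comment> \<open>The cyclic shift from a sector to its lower half-line; index 0 wraps to N - 1,
    which is legitimate by S N = S 0.\<close>
  define f where "f = (\<lambda>i. if i = 0 then N - 1 else i - 1)"
  have "inj_on f T" using N by (auto simp: inj_on_def f_def T_def)
  moreover have "f ` T \<subseteq> T'" using N wrap by (auto simp: f_def T_def T'_def)
  ultimately have "card T \<le> card T'" using fin by (metis card_inj_on_le)
  moreover have "card (A \<union> T \<union> T') = card A + card T + card T'"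
    using fin adj acc by (subst card_Un_disjoint; (subst card_Un_disjoint)?) (auto simp: T_def T'_def A_def)
  moreover have "card (A \<union> T \<union> T') \<le> card {..<N}"
    by (rule card_mono) (auto simp: T_def T'_def A_def)
  ultimately show ?thesis by (simp add: T_def A_def)
qed

text \<open>On the bisector of S_j the leading term of V has sign (-1)^j. The same sign in the
  polynomial W compensates it, so exp W grows in S_j for every j.\<close>

lemma stokes_sector_family:
  fixes V U :: "complex poly" and H :: real
  assumes H: "H > 0" and d: "d \<ge> 1"
    and deg: "degree V = d + 1" and degR: "degree (smult (1/4) (pderiv V ^ 2) - U) < d"
    and hol: "\<psi> holomorphic_on UNIV" and nz: "\<exists>x. \<psi> x \<noteq> 0"
    and ode: "\<And>x. (of_real H)\<^sup>2 * deriv (deriv \<psi>) x = poly U x * \<psi> x"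
  shows "stokes_sector (smult ((-1) ^ j / (2 * of_real H)) V)
     (smult (1 / (of_real H)\<^sup>2) (smult (1/4) (pderiv V ^ 2) - U)) (d + 1)
     (cmod (lead_coeff V) / (2 * H)) (cis (sector_center V d j)) \<psi>"
proof
  show "2 \<le> d + 1" using d by simp
  show "degree (smult ((-1) ^ j / (2 * of_real H)) V) = d + 1" using H deg by simp
  show "degree (smult (1 / (of_real H)\<^sup>2) (smult (1 / 4) ((pderiv V)\<^sup>2) - U)) < 2 * (d + 1 - 1)"
    using degR H by simp
  show "\<psi> holomorphic_on UNIV" "\<exists>x. \<psi> x \<noteq> 0" by fact+
  show "cmod (cis (sector_center V d j)) = 1" by simp
  have l0: "lead_coeff V \<noteq> 0" using deg by (intro leading_coeff_neq_0) auto
  show "0 < cmod (lead_coeff V) / (2 * H)" using H l0 by simp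
  fix x
  have sq: "((-1) ^ j * (-1) ^ j :: complex) = 1" by (simp flip: power_mult_distrib)
  have Hc: "complex_of_real H \<noteq> 0" using H by simp
  have "poly ((pderiv (smult ((-1) ^ j / (2 * of_real H)) V))\<^sup>2 -
         smult (1 / (of_real H)\<^sup>2) (smult (1 / 4) ((pderiv V)\<^sup>2) - U)) x
      = ((-1) ^ j / (2 * of_real H) * poly (pderiv V) x)\<^sup>2 - 1 / (of_real H)\<^sup>2 * (1 / 4 * (poly (pderiv V) x)\<^sup>2 - poly U x)"
    by (simp add: pderiv_smult)
  also have "\<dots> = poly U x / (of_real H)\<^sup>2"
    using Hc sq by (simp add: power_mult_distrib power_divide power2_eq_square field_simps)
  finally show "deriv (deriv \<psi>) x = poly ((pderiv (smult ((-1) ^ j / (2 * of_real H)) V))\<^sup>2 -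
         smult (1 / (of_real H)\<^sup>2) (smult (1 / 4) ((pderiv V)\<^sup>2) - U)) x * \<psi> x"
    using ode[of x] Hc by (simp add: field_simps)
next
  have l0: "lead_coeff V \<noteq> 0" using deg by (intro leading_coeff_neq_0) auto
  have lc: "lead_coeff (pderiv V) = of_nat (d + 1) * lead_coeff V"
    by (simp add: degree_pderiv deg coeff_pderiv)
  have "Arg (lead_coeff (pderiv V)) = Arg (lead_coeff V)"
    unfolding lc using Arg_times_of_real[of "real (d + 1)" "lead_coeff V"] by simp
  then have "real (d + 1) * sector_center V d j = - Arg (lead_coeff V) + pi * real j"
    unfolding sector_center_def by (simp add: distrib_left right_diff_distrib)
  then have "cis (sector_center V d j) ^ (d + 1) = cis (- Arg (lead_coeff V)) * cis (pi * real j)"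
    by (simp only: Complex.DeMoivre cis_mult)
  also have "cis (pi * real j) = (-1) ^ j"
    using Complex.DeMoivre[of pi j] by (simp add: mult.commute)
  finally have c: "cis (sector_center V d j) ^ (d + 1) = cis (- Arg (lead_coeff V)) * (-1) ^ j" .
  have L: "lead_coeff V = of_real (cmod (lead_coeff V)) * cis (Arg (lead_coeff V))"
    using Arg_eq[OF l0] by (simp add: cis_conv_exp)
  have "lead_coeff (smult ((-1) ^ j / (2 * of_real H)) V) * cis (sector_center V d j) ^ (d + 1)
      = (-1) ^ j / (2 * of_real H) * (of_real (cmod (lead_coeff V)) * cis (Arg (lead_coeff V))) *
        (cis (- Arg (lead_coeff V)) * (-1) ^ j)"
    unfolding c lead_coeff_smult using L by simp
  also have "\<dots> = of_real (cmod (lead_coeff V) / (2 * H)) * (cis (Arg (lead_coeff V)) * cis (- Arg (lead_coeff V))) *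
      ((-1) ^ j * (-1) ^ j)"
    by simp
  also have "\<dots> = of_real (cmod (lead_coeff V) / (2 * H))"
    by (simp add: cis_mult flip: power_mult_distrib)
  finally show "lead_coeff (smult ((-1) ^ j / (2 * of_real H)) V) * cis (sector_center V d j) ^ (d + 1)
      = of_real (cmod (lead_coeff V) / (2 * H))" .
qed

text \<open>As d < 2 d, the leading term of U must be cancelled by that of V'^2/4.\<close>

lemma degree_of_square_root_primitive:
  fixes U V :: "complex poly"
  assumes d: "d \<ge> 1" and degU: "degree U = 2 * d"
    and degR: "degree (smult (1/4) (pderiv V ^ 2) - U) < d"
  shows "degree V = d + 1"
proof -
  define p where "p = smult (1/4) (pderiv V ^ 2)"
  have "degree p = 2 * degree (pderiv V)"
    by (cases "pderiv V = 0") (auto simp: p_def degree_power_eq)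
  moreover have "degree U \<le> max (degree p) (degree (p - U))"
    using degree_diff_le_max[of p "p - U"] by simp
  moreover have "degree p \<le> max (degree (p - U)) (degree U)"
    using degree_add_le_max[of "p - U" U] by simp
  ultimately have "degree (pderiv V) = d" using d degU degR by (auto simp: p_def[symmetric])
  then show ?thesis using d by (simp add: degree_pderiv)
qed

section \<open>All sectors together\<close>

locale stokes_family =
  fixes V U :: "complex poly" and d :: nat and H :: real and \<psi> :: "complex \<Rightarrow> complex"
  assumes H: "H > 0" and d2: "d \<ge> 2"
    and deg: "degree V = d + 1" and degR: "degree (smult (1/4) (pderiv V ^ 2) - U) < d"
    and entire: "\<psi> holomorphic_on UNIV" and nonzero: "\<exists>x. \<psi> x \<noteq> 0"
    and equation: "\<And>x. (of_real H)\<^sup>2 * deriv (deriv \<psi>) x = poly U x * \<psi> x"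
begin

definition W :: "nat \<Rightarrow> complex poly" where "W j = smult ((-1) ^ j / (2 * of_real H)) V"

definition scale :: real where "scale = cmod (lead_coeff V) / (2 * H)"

definition small_in :: "nat \<Rightarrow> bool" where
  "small_in j = stokes_sector.small (W j) (d + 1) scale (cis (sector_center V d j)) \<psi>"

lemma at_sector: "stokes_sector (W j) (smult (1 / (of_real H)\<^sup>2) (smult (1/4) (pderiv V ^ 2) - U))
    (d + 1) scale (cis (sector_center V d j)) \<psi>"
  unfolding W_def scale_def
  by (rule stokes_sector_family) (use H d2 deg degR entire nonzero equation in auto)

lemma closed_subsector_sector:
  "closed_subsector V d j \<delta> = stokes_sector.sector (d + 1) (cis (sector_center V d j)) \<delta>"
  unfolding closed_subsector_eq stokes_sector.sector_def[OF at_sector[of j]] ..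

lemma exp_small_imp_small_in:
  assumes "exp_small V d \<psi> j"
  shows "small_in j"
proof -
  \<comment> \<open>The extreme margin, which shrinks the closed subsector to the bisecting
    ray.\<close>
  define \<delta> where "\<delta> = pi / (2 * real (d + 1))"
  have \<delta>: "0 < \<delta>" "\<delta> \<le> pi / (2 * real (d + 1))" by (simp_all add: \<delta>_def)
  then obtain c where c: "c > 0" "eventually (\<lambda>x. norm (\<psi> x) \<le> exp (- c * norm x)) (sector_filter V d j \<delta>)"
    using assms unfolding exp_small_def by blast
  then obtain R where R: "\<And>x. x \<in> closed_subsector V d j \<delta> \<Longrightarrow> cmod x \<ge> R \<Longrightarrow> cmod (\<psi> x) \<le> exp (- c * cmod x)"
    unfolding eventually_sector_filter by blast
  show ?thesis unfolding small_in_def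
  proof (rule stokes_sector.small_if_bounded_on_ray[OF at_sector _ \<delta>])
    show "3 \<le> d + 1" using d2 by simp
    fix x assume "x \<in> stokes_sector.sector (d + 1) (cis (sector_center V d j)) \<delta>" "R \<le> cmod x"
    then have "cmod (\<psi> x) \<le> exp (- c * cmod x)" using R by (simp only: closed_subsector_sector)
    also have "\<dots> \<le> 1" using c by simp
    finally show "cmod (\<psi> x) \<le> 1" .
  qed
qed

lemma small_in_beyond:
  assumes "small_in j"
  obtains R where "R > 0" "\<And>s \<theta>. s \<ge> R \<Longrightarrow> \<bar>\<theta>\<bar> \<le> 2 * pi / (3 * real (d + 1)) \<Longrightarrow>
     (let x = cis (sector_center V d j) * (of_real s * cis \<theta>) in
      cmod (deriv \<psi> x + poly (pderiv (W j)) x * \<psi> x) < cmod (deriv \<psi> x - poly (pderiv (W j)) x * \<psi> x))"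
  using stokes_sector.small_beyond_sector[OF at_sector assms[unfolded small_in_def]] by blast

text \<open>Passing to the next sector replaces W by -W and thereby exchanges the two sides of the
  strict inequality; on the shared half-line both versions would have to hold.\<close>

lemma small_in_not_adjacent:
  assumes "small_in j"
  shows "\<not> small_in (Suc j)"
proof
  assume "small_in (Suc j)"
  define q where "q = pi / (2 * real (d + 1))"
  have q: "\<bar>q\<bar> \<le> 2 * pi / (3 * real (d + 1))" "\<bar>- q\<bar> \<le> 2 * pi / (3 * real (d + 1))"
    by (auto simp: q_def field_simps)
  obtain R where R: "R > 0" "\<And>s \<theta>. s \<ge> R \<Longrightarrow> \<bar>\<theta>\<bar> \<le> 2 * pi / (3 * real (d + 1)) \<Longrightarrow>
     (let x = cis (sector_center V d j) * (of_real s * cis \<theta>) in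
      cmod (deriv \<psi> x + poly (pderiv (W j)) x * \<psi> x) < cmod (deriv \<psi> x - poly (pderiv (W j)) x * \<psi> x))"
    using small_in_beyond[OF \<open>small_in j\<close>] by blast
  obtain R' where R': "R' > 0" "\<And>s \<theta>. s \<ge> R' \<Longrightarrow> \<bar>\<theta>\<bar> \<le> 2 * pi / (3 * real (d + 1)) \<Longrightarrow>
     (let x = cis (sector_center V d (Suc j)) * (of_real s * cis \<theta>) in
      cmod (deriv \<psi> x + poly (pderiv (W (Suc j))) x * \<psi> x) < cmod (deriv \<psi> x - poly (pderiv (W (Suc j))) x * \<psi> x))"
    using small_in_beyond[OF \<open>small_in (Suc j)\<close>] by blast
  define s where "s = max R R'"
  define x where "x = cis (sector_center V d j) * (of_real s * cis q)"
  have "sector_center V d (Suc j) + - q = sector_center V d j + q"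
    using sector_center_Suc[of V d j] half_sector[of d] by (simp only: q_def)
  then have "cis (sector_center V d (Suc j)) * cis (- q) = cis (sector_center V d j) * cis q"
    by (simp only: cis_mult)
  then have x': "x = cis (sector_center V d (Suc j)) * (of_real s * cis (- q))"
    unfolding x_def by (metis mult.left_commute)
  have "W (Suc j) = - W j" by (simp add: W_def)
  then have W': "poly (pderiv (W (Suc j))) x = - poly (pderiv (W j)) x" by (simp add: pderiv_minus)
  have "cmod (deriv \<psi> x + poly (pderiv (W j)) x * \<psi> x) < cmod (deriv \<psi> x - poly (pderiv (W j)) x * \<psi> x)"
    using R(2)[OF _ q(1), of s] unfolding Let_def x_def[symmetric] by (simp add: s_def)
  moreover have "cmod (deriv \<psi> x + poly (pderiv (W (Suc j))) x * \<psi> x) < cmod (deriv \<psi> x - poly (pderiv (W (Suc j))) x * \<psi> x)"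
    using R'(2)[OF _ q(2), of s] unfolding Let_def x'[symmetric] by (simp add: s_def)
  ultimately show False unfolding W' by simp
qed

text \<open>At a zero of \<psi> the W' terms drop out and the strict inequality would read |\<psi>'|
  < |\<psi>'|. Zeros in the enlarged sector are therefore bounded, hence finite in number.\<close>

lemma small_in_not_accumulates:
  assumes "small_in i" and near: "\<bar>stokes_angle V d j - sector_center V d i\<bar> \<le> pi / (2 * real (d + 1))"
  shows "\<not> accumulates V d \<psi> j"
proof
  assume acc: "accumulates V d \<psi> j"
  obtain R where R: "R > 0" "\<And>s \<theta>. s \<ge> R \<Longrightarrow> \<bar>\<theta>\<bar> \<le> 2 * pi / (3 * real (d + 1)) \<Longrightarrow>
     (let x = cis (sector_center V d i) * (of_real s * cis \<theta>) in
      cmod (deriv \<psi> x + poly (pderiv (W i)) x * \<psi> x) < cmod (deriv \<psi> x - poly (pderiv (W i)) x * \<psi> x))"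
    using small_in_beyond[OF \<open>small_in i\<close>] by blast
  \<comment> \<open>The margin 2 pi / (3 N) - pi / (2 N) for N = d + 1.\<close>
  define \<epsilon> where "\<epsilon> = pi / (6 * real (d + 1))"
  have "\<epsilon> > 0" by (simp add: \<epsilon>_def)
  have sum: "pi / (2 * real (d + 1)) + \<epsilon> = 2 * pi / (3 * real (d + 1))"
  proof -
    have "p / (2 * N) + p / (6 * N) = 2 * p / (3 * N)" if "N > 0" for p N :: real
      using that by (simp add: field_simps)
    from this[of "real (d + 1)" pi] show ?thesis unfolding \<epsilon>_def by simp
  qed
  have "{s. \<psi> s = 0 \<and> (\<exists>r \<phi>. r > 0 \<and> \<bar>\<phi> - stokes_angle V d j\<bar> < \<epsilon> \<and> s = of_real r * cis \<phi>)}
      \<subseteq> {x. cmod x \<le> R \<and> \<psi> x = 0}"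
  proof (rule subsetI)
    fix x assume "x \<in> {s. \<psi> s = 0 \<and> (\<exists>r \<phi>. r > 0 \<and> \<bar>\<phi> - stokes_angle V d j\<bar> < \<epsilon> \<and> s = of_real r * cis \<phi>)}"
    then obtain r \<phi> where x: "\<psi> x = 0" "r > 0" "\<bar>\<phi> - stokes_angle V d j\<bar> < \<epsilon>" "x = of_real r * cis \<phi>" by blast
    have "r \<le> R"
    proof (rule ccontr)
      assume "\<not> r \<le> R"
      then have "R \<le> r" by simp
      moreover have "\<bar>\<phi> - sector_center V d i\<bar> \<le> 2 * pi / (3 * real (d + 1))"
        using near x(3) unfolding sum[symmetric] by linarith
      moreover have "cis (sector_center V d i) * (of_real r * cis (\<phi> - sector_center V d i)) = x"
        by (simp add: x(4) cis_mult mult.left_commute)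
      ultimately show False using R(2)[of r "\<phi> - sector_center V d i"] x(1) by (simp add: Let_def)
    qed
    then show "x \<in> {x. cmod x \<le> R \<and> \<psi> x = 0}" using x by (simp add: norm_mult)
  qed
  then have "finite {s. \<psi> s = 0 \<and> (\<exists>r \<phi>. r > 0 \<and> \<bar>\<phi> - stokes_angle V d j\<bar> < \<epsilon> \<and> s = of_real r * cis \<phi>)}"
    by (rule finite_subset) (rule entire_zeros_bounded_finite[OF entire nonzero])
  with acc \<open>\<epsilon> > 0\<close> show False unfolding accumulates_def by blast
qed

lemma small_in_periodic: "small_in (2 * d + 2) = small_in 0"
proof -
  have "sector_center V d (2 * d + 2) = sector_center V d 0 + 2 * pi"
  proof -
    have "a / N + p * (2 * N) / N = a / N + p * 0 / N + 2 * p" if "N > 0" for a p N :: real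
      using that by simp
    from this[of "real (d + 1)" "- Arg (lead_coeff (pderiv V))" pi]
    have "- Arg (lead_coeff (pderiv V)) / real (d + 1) + pi * real (2 * d + 2) / real (d + 1) =
        - Arg (lead_coeff (pderiv V)) / real (d + 1) + pi * real 0 / real (d + 1) + 2 * pi"
      by simp
    then show ?thesis unfolding sector_center_def .
  qed
  then have "cis (sector_center V d (2 * d + 2)) = cis (sector_center V d 0)"
    by (simp add: complex_eq_iff)
  moreover have "W (2 * d + 2) = W 0" by (simp add: W_def)
  ultimately show ?thesis unfolding small_in_def by simp
qed

lemma card_accumulates:
  "card {j. j < 2 * d + 2 \<and> accumulates V d \<psi> j} + 2 * card {j. j < 2 * d + 2 \<and> small_in j} \<le> 2 * d + 2"
proof (rule card_no_adjacent)
  show "small_in (2 * d + 2) = small_in 0" by (rule small_in_periodic)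
  fix j
  show "\<not> small_in (Suc j)" if "small_in j" using small_in_not_adjacent[OF that] .
  show "\<not> accumulates V d \<psi> j" if "small_in j"
    by (rule small_in_not_accumulates[OF that]) (simp add: stokes_angle_eq)
  show "\<not> accumulates V d \<psi> j" if "small_in (Suc j)"
  proof (rule small_in_not_accumulates[OF that])
    have "s - c' = - q" if "c' = c + p" "p = 2 * q" "s = c + q" for s c c' p q :: real
      using that by simp
    from this[OF sector_center_Suc half_sector stokes_angle_eq]
    have "stokes_angle V d j - sector_center V d (Suc j) = - (pi / (2 * real (d + 1)))" .
    then show "\<bar>stokes_angle V d j - sector_center V d (Suc j)\<bar> \<le> pi / (2 * real (d + 1))" by simp
  qed
qed simp

lemma not_small_in_estimate:
  assumes "\<not> small_in j" and F: "\<And>x. (F has_field_derivative poly h x * (\<psi> x)\<^sup>2) (at x)"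
    and degh: "degree h \<le> d - 2" and \<delta>: "\<delta> > 0"
  shows "\<exists>R K. \<forall>x\<in>closed_subsector V d j \<delta>. cmod x \<ge> R \<longrightarrow>
      \<psi> x \<noteq> 0 \<and> cmod (F x) \<le> K * cmod ((\<psi> x / x)\<^sup>2)"
proof -
  have "degree h + 2 \<le> d + 1 - 1" using degh d2 by simp
  from stokes_sector.large_sector[OF at_sector assms(1)[unfolded small_in_def] F this \<delta>]
  show ?thesis unfolding closed_subsector_sector by blast
qed

text \<open>L does not depend on \<delta>, so limits along paths ending in different subsectors of
  S_j can be identified.\<close>

lemma small_in_estimate:
  assumes "small_in j" and F: "\<And>x. (F has_field_derivative poly h x * (\<psi> x)\<^sup>2) (at x)"
    and degh: "degree h \<le> d - 2"
  obtains L where "\<And>\<delta>. \<delta> > 0 \<Longrightarrow> \<exists>R K. \<forall>x\<in>closed_subsector V d j \<delta>. cmod x \<ge> R \<longrightarrow>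
      \<psi> x \<noteq> 0 \<and> cmod (F x - L) \<le> K * cmod ((\<psi> x / x)\<^sup>2)"
    "\<And>\<delta>. \<delta> > 0 \<Longrightarrow> (F \<longlongrightarrow> L) (sector_filter V d j \<delta>)"
proof -
  have "degree h + 2 \<le> d + 1 - 1" using degh d2 by simp
  from stokes_sector.small_sector[OF at_sector assms(1)[unfolded small_in_def] F this]
  obtain L where L: "\<And>\<delta>. \<delta> > 0 \<Longrightarrow> \<exists>R K k c. K > 0 \<and> k > 0 \<and> c > 0 \<and> (\<forall>x\<in>closed_subsector V d j \<delta>. cmod x \<ge> R \<longrightarrow>
      \<psi> x \<noteq> 0 \<and> cmod (F x - L) \<le> K * cmod ((\<psi> x / x)\<^sup>2) \<and> cmod ((\<psi> x / x)\<^sup>2) \<le> k * exp (- (c * cmod x)))"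
    unfolding closed_subsector_sector by blast
  show thesis
  proof (rule that)
    fix \<delta> :: real assume \<delta>: "\<delta> > 0"
    show "\<exists>R K. \<forall>x\<in>closed_subsector V d j \<delta>. cmod x \<ge> R \<longrightarrow>
      \<psi> x \<noteq> 0 \<and> cmod (F x - L) \<le> K * cmod ((\<psi> x / x)\<^sup>2)" using L[OF \<delta>] by blast
  next
    fix \<delta> :: real assume \<delta>: "\<delta> > 0"
    from L[OF this] obtain R K k c where *: "K > 0" "k > 0" "c > 0"
      "\<And>x. x \<in> closed_subsector V d j \<delta> \<Longrightarrow> cmod x \<ge> R \<Longrightarrow>
      \<psi> x \<noteq> 0 \<and> cmod (F x - L) \<le> K * cmod ((\<psi> x / x)\<^sup>2) \<and> cmod ((\<psi> x / x)\<^sup>2) \<le> k * exp (- (c * cmod x))" by blast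
    have "((\<lambda>s. K * k * (s ^ 0 * exp (- (c * s)))) \<longlongrightarrow> K * k * 0) at_top"
      by (intro tendsto_mult tendsto_const power_times_exp_tendsto_0 *)
    then have "((\<lambda>s. K * k * exp (- (c * s))) \<longlongrightarrow> 0) at_top" by simp
    moreover have "filterlim cmod at_top (sector_filter V d j \<delta>)"
      unfolding sector_filter_def by (rule filterlim_mono[OF filterlim_at_infinity_imp_norm_at_top[OF filterlim_ident] order_refl inf_le1])
    ultimately have lim: "((\<lambda>x. K * k * exp (- (c * cmod x))) \<longlongrightarrow> 0) (sector_filter V d j \<delta>)"
      by (rule filterlim_compose)
    have "((\<lambda>x. F x - L) \<longlongrightarrow> 0) (sector_filter V d j \<delta>)"
    proof (rule Lim_null_comparison[OF _ lim], unfold eventually_sector_filter, intro exI[of _ R] ballI impI)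
      fix x assume x: "x \<in> closed_subsector V d j \<delta>" "R \<le> cmod x"
      have "cmod (F x - L) \<le> K * cmod ((\<psi> x / x)\<^sup>2)" using *(4)[OF x] by blast
      also have "\<dots> \<le> K * (k * exp (- (c * cmod x)))" using *(4)[OF x] *(1) by (intro mult_left_mono) auto
      finally show "norm (F x - L) \<le> K * k * exp (- (c * cmod x))" by (simp add: mult.assoc)
    qed
    then show "(F \<longlongrightarrow> L) (sector_filter V d j \<delta>)" by (rule Lim_null[THEN iffD2])
  qed
qed

lemma filterlim_central_ray:
  "filterlim (\<lambda>s. of_real s * cis (sector_center V d j)) (sector_filter V d j (pi / (2 * real (d + 1)))) at_top"
  unfolding sector_filter_def filterlim_inf filterlim_principal
proof
  show "filterlim (\<lambda>s. of_real s * cis (sector_center V d j)) at_infinity at_top"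
  proof (rule filterlim_norm_at_top_imp_at_infinity)
    have "\<forall>\<^sub>F s in at_top. s = norm (of_real s * cis (sector_center V d j))"
      using eventually_ge_at_top[of 0] by eventually_elim (simp add: norm_mult)
    then show "filterlim (\<lambda>s. norm (of_real s * cis (sector_center V d j))) at_top at_top"
      by (rule filterlim_mono_eventually[OF filterlim_ident order_refl order_refl])
  qed
  show "\<forall>\<^sub>F s in at_top. of_real s * cis (sector_center V d j) \<in> closed_subsector V d j (pi / (2 * real (d + 1)))"
    using eventually_gt_at_top[of 0]
  proof eventually_elim
    case (elim s)
    show ?case unfolding closed_subsector_eq
      by (rule CollectI, rule exI[of _ s], rule exI[of _ 0]) (use elim in auto)
  qed
qed

end

text \<open>Hypothesis \<open>V\<close> is the algebraic form of V' = 2 (sqrt U)_+, up to the choice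
  of the root: it makes one of V'/2 - sqrt U and V'/2 + sqrt U of order x^-1 at infinity. The
  estimates are claimed on closed subsectors, since zeros of \<psi> may run along the half-lines.
  All degenerate cycles leave from S_0, so injectivity of \<open>b\<close> yields d - 1 - g distinct
  end sectors.\<close>

theorem mainTheorem2:
  fixes \<h> :: complex and d g :: nat and U V :: "complex poly"
    and \<psi> :: "complex \<Rightarrow> complex"
    and h :: "nat \<Rightarrow> complex poly"
    and p q b :: "nat \<Rightarrow> nat"
    and \<gamma>A \<gamma>D :: "nat \<Rightarrow> real \<Rightarrow> complex"
  assumes hbar: "\<h> \<noteq> 0"
    and d: "d \<ge> 1"
    and degU: "degree U = 2 * d"
    and V: "degree (smult (1/4) (pderiv V ^ 2) - U) < d"
    and psi_entire: "\<psi> holomorphic_on UNIV"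
    and psi_ode: "\<forall>x. \<h>\<^sup>2 * deriv (deriv \<psi>) x = poly U x * \<psi> x"
    and psi_nonzero: "\<exists>x. \<psi> x \<noteq> 0"
    and psi_dec0: "exp_small V d \<psi> 0"
    and eta0: "physical V d \<h> \<psi> 0"
    and genus: "2 * g + 2 = card {j. j < 2 * d + 2 \<and> accumulates V d \<psi> j}"
    and h_deg: "\<forall>k\<in>{1..d-1}. degree (h k) \<le> d - 2"
    and h_basis: "\<forall>c. (\<Sum>k=1..d-1. smult (c k) (h k)) = 0 \<longrightarrow> (\<forall>k\<in>{1..d-1}. c k = 0)"
    and A_sectors: "\<forall>\<alpha>\<in>{1..g}. p \<alpha> < 2 * d + 2 \<and> q \<alpha> < 2 * d + 2 \<and> p \<alpha> \<noteq> q \<alpha>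
                      \<and> physical V d \<h> \<psi> (p \<alpha>) \<and> physical V d \<h> \<psi> (q \<alpha>)"
    and A_paths: "\<forall>\<alpha>\<in>{1..g}. \<gamma>A \<alpha> piecewise_C1_differentiable_on UNIV
                      \<and> (\<forall>t. \<psi> (\<gamma>A \<alpha> t) \<noteq> 0)
                      \<and> ends_in V d (p \<alpha>) (\<gamma>A \<alpha>) at_bot \<and> ends_in V d (q \<alpha>) (\<gamma>A \<alpha>) at_top"
    and A_norm: "\<forall>k\<in>{1..d-1}. \<forall>\<alpha>\<in>{1..g}.
                   path_integral_is (\<gamma>A \<alpha>) (vfun V d \<h> \<psi> (h k)) (if k = \<alpha> then 1 else 0)"
    and D_sectors: "\<forall>\<alpha>\<in>{g+1..d-1}. b \<alpha> < 2 * d + 2 \<and> b \<alpha> \<noteq> 0 \<and> exp_small V d \<psi> (b \<alpha>)"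
    and D_indep: "inj_on b {g+1..d-1}"
    and D_paths: "\<forall>\<alpha>\<in>{g+1..d-1}. \<gamma>D \<alpha> piecewise_C1_differentiable_on UNIV
                      \<and> ends_in V d 0 (\<gamma>D \<alpha>) at_bot \<and> ends_in V d (b \<alpha>) (\<gamma>D \<alpha>) at_top"
    and D_norm: "\<forall>k\<in>{1..d-1}. \<forall>\<alpha>\<in>{g+1..d-1}.
                   path_integral_is (\<gamma>D \<alpha>) (\<lambda>y. poly (h k) y * \<psi> y ^ 2) (if k = \<alpha> then 1 else 0)"
  shows "\<forall>k\<in>{1..d-1}. \<forall>j<2 * d + 2.
           (if k \<le> g \<or> j \<noteq> b k
            then sector_bigo V d j (vfun V d \<h> \<psi> (h k)) (\<lambda>x. 1 / x ^ 2)
            else sector_bigo V d j (\<lambda>x. vfun V d \<h> \<psi> (h k) x - 1 / (\<h> * \<psi> x ^ 2)) (\<lambda>x. 1 / x ^ 2))"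
proof (intro ballI allI impI)
  fix k j assume k: "k \<in> {1..d-1}" and j: "j < 2 * d + 2"
  have d2: "d \<ge> 2" using k by auto
  have degV: "degree V = d + 1" using degree_of_square_root_primitive[OF d degU V] .
  obtain H where H: "H > 0" "\<h> = of_real H"
    using positive_real_if_half_plane[OF hbar
        poly_over_hbar_nonneg[OF hbar degV psi_entire psi_nonzero psi_dec0 eta0]] by blast
  interpret stokes_family V U d H \<psi>
    by unfold_locales (use H d2 degV V psi_entire psi_nonzero psi_ode in auto)
  define S where "S = {j. j < 2 * d + 2 \<and> small_in j}"
  have S0: "0 \<in> S" using exp_small_imp_small_in[OF psi_dec0] by (simp add: S_def)
  have finS: "finite S" by (simp add: S_def)
  \<comment> \<open>Counting S_0 alone gives g <= d - 1, so d - 1 - g below is a true difference and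
    not a truncated one.\<close>
  have "card S \<ge> 1" using S0 finS by (metis One_nat_def Suc_leI card_gt_0_iff empty_iff)
  moreover have "2 * g + 2 + 2 * card S \<le> 2 * d + 2"
    using card_accumulates unfolding genus S_def .
  ultimately have gd: "card S \<le> d - g" "g \<le> d - 1" using d by linarith+
  have "S = insert 0 (b ` {g+1..d-1})"
  \<comment> \<open>The known small sectors already number 1 + (d - 1 - g) = d - g, the upper bound
    from the count, so there are no others.\<close>
  proof (rule card_seteq[OF finS, symmetric])
    show "insert 0 (b ` {g+1..d-1}) \<subseteq> S"
      using S0 D_sectors exp_small_imp_small_in by (auto simp: S_def)
    have "0 \<notin> b ` {g+1..d-1}" using D_sectors by auto
    then have "card (insert 0 (b ` {g+1..d-1})) = Suc (d - 1 - g)"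
      using D_indep by (simp add: card_image)
    then show "card S \<le> card (insert 0 (b ` {g+1..d-1}))" using gd d by simp
  qed
  then have small_iff: "i < 2 * d + 2 \<Longrightarrow> small_in i \<longleftrightarrow> i = 0 \<or> i \<in> b ` {g+1..d-1}" for i
    by (auto simp: S_def set_eq_iff)
  define f where "f = (\<lambda>y. poly (h k) y * (\<psi> y)\<^sup>2)"
  have "poly (h k) holomorphic_on UNIV"
    unfolding holomorphic_on_def field_differentiable_def
    by (blast intro: poly_DERIV has_field_derivative_at_within)
  then have hol_f: "f holomorphic_on UNIV"
    unfolding f_def by (intro holomorphic_intros psi_entire)
  then obtain P where "\<And>x. x \<in> UNIV \<Longrightarrow> (P has_field_derivative f x) (at x within UNIV)"
    using holomorphic_convex_primitive'[OF convex_UNIV open_UNIV] by blast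
  then have P: "(P has_field_derivative f x) (at x)" for x by simp
  note P' = P[unfolded f_def]
  have contf: "continuous_on UNIV f" using hol_f by (rule holomorphic_on_imp_continuous_on)
  have degh: "degree (h k) \<le> d - 2" using h_deg k by blast
  obtain L0 where L0: "\<And>\<delta>. \<delta> > 0 \<Longrightarrow> \<exists>R K. \<forall>x\<in>closed_subsector V d 0 \<delta>. cmod x \<ge> R \<longrightarrow>
      \<psi> x \<noteq> 0 \<and> cmod (P x - L0) \<le> K * cmod ((\<psi> x / x)\<^sup>2)"
    "\<And>\<delta>. \<delta> > 0 \<Longrightarrow> (P \<longlongrightarrow> L0) (sector_filter V d 0 \<delta>)"
    using small_in_estimate[OF exp_small_imp_small_in[OF psi_dec0] P' degh] by blast
  have "int_from_inf0 V d f x = P x - L0" for x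
  proof (rule int_from_inf0_eq[OF P contf])
    have c: "- Arg (lead_coeff (pderiv V)) / real (d + 1) = sector_center V d 0"
      by (simp add: sector_center_def)
    show "((\<lambda>s. P (of_real s * cis (- Arg (lead_coeff (pderiv V)) / real (d + 1)))) \<longlongrightarrow> L0) at_top"
      unfolding c by (rule filterlim_compose[OF L0(2) filterlim_central_ray]) simp
  qed
  then have v: "vfun V d \<h> \<psi> (h k) x = (P x - L0) / (\<h> * \<psi> x ^ 2)" for x
    by (simp add: vfun_def f_def)
  show "if k \<le> g \<or> j \<noteq> b k
            then sector_bigo V d j (vfun V d \<h> \<psi> (h k)) (\<lambda>x. 1 / x ^ 2)
            else sector_bigo V d j (\<lambda>x. vfun V d \<h> \<psi> (h k) x - 1 / (\<h> * \<psi> x ^ 2)) (\<lambda>x. 1 / x ^ 2)"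
  proof (cases "small_in j")
    case False
    \<comment> \<open>The large bound holds for every primitive, so subtracting L0 changes nothing
      here.\<close>
    have der: "((\<lambda>x. P x - L0) has_field_derivative poly (h k) x * (\<psi> x)\<^sup>2) (at x)" for x
      using DERIV_diff[OF P' DERIV_const] by simp
    have "sector_bigo V d j (\<lambda>x. (P x - L0) / (\<h> * \<psi> x ^ 2)) (\<lambda>x. 1 / x ^ 2)"
      by (rule sector_bigo_quotient[OF hbar not_small_in_estimate[OF False der degh]])
    moreover have "k \<le> g \<or> j \<noteq> b k" using False small_iff[OF j] k by auto
    ultimately show ?thesis by (simp add: v[abs_def])
  next
    case True
    obtain L where L: "\<And>\<delta>. \<delta> > 0 \<Longrightarrow> \<exists>R K. \<forall>x\<in>closed_subsector V d j \<delta>. cmod x \<ge> R \<longrightarrow>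
        \<psi> x \<noteq> 0 \<and> cmod (P x - L) \<le> K * cmod ((\<psi> x / x)\<^sup>2)"
      "\<And>\<delta>. \<delta> > 0 \<Longrightarrow> (P \<longlongrightarrow> L) (sector_filter V d j \<delta>)"
      using small_in_estimate[OF True P' degh] by blast
    have big: "sector_bigo V d j (\<lambda>x. (P x - L) / (\<h> * \<psi> x ^ 2)) (\<lambda>x. 1 / x ^ 2)"
      by (rule sector_bigo_quotient[OF hbar L(1)])
    from True small_iff[OF j] consider "j = 0" | \<alpha> where "\<alpha> \<in> {g+1..d-1}" "j = b \<alpha>" by blast
    then show ?thesis
    proof cases
      case 1
      \<comment> \<open>L and L0 come from separate existence statements; uniqueness of the limit on
        the bisecting ray identifies them.\<close>
      have "L = L0"
      proof (rule tendsto_unique)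
        have p: "pi / (2 * real (d + 1)) > 0" by simp
        show "((\<lambda>s. P (of_real s * cis (sector_center V d 0))) \<longlongrightarrow> L) at_top"
          using filterlim_compose[OF L(2)[OF p, unfolded 1] filterlim_central_ray] .
        show "((\<lambda>s. P (of_real s * cis (sector_center V d 0))) \<longlongrightarrow> L0) at_top"
          using filterlim_compose[OF L0(2)[OF p] filterlim_central_ray] .
      qed simp
      moreover have "k \<le> g \<or> j \<noteq> b k"
      proof (cases "k \<le> g")
        case False
        then have "k \<in> {g+1..d-1}" using k by simp
        with D_sectors 1 show ?thesis by metis
      qed simp
      ultimately show ?thesis using big by (simp add: v[abs_def])
    next
      case 2
      have e: "ends_in V d 0 (\<gamma>D \<alpha>) at_bot" "ends_in V d j (\<gamma>D \<alpha>) at_top"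
        and pc: "\<gamma>D \<alpha> piecewise_C1_differentiable_on UNIV" using D_paths 2 by auto
      have int: "path_integral_is (\<gamma>D \<alpha>) f (if k = \<alpha> then 1 else 0)"
        using D_norm k 2 unfolding f_def by blast
      have lim0: "((\<lambda>t. P (\<gamma>D \<alpha> t)) \<longlongrightarrow> L0) at_bot"
        using ends_in_filterlim[OF e(1)] filterlim_compose[OF L0(2)] by metis
      have lim1: "((\<lambda>t. P (\<gamma>D \<alpha> t)) \<longlongrightarrow> L) at_top"
        using ends_in_filterlim[OF e(2)] filterlim_compose[OF L(2)] by metis
      \<comment> \<open>The integral over the degenerate cycle is the difference of the limits of P
        at its two ends.\<close>
      have LL: "L = L0 + (if k = \<alpha> then 1 else 0)"
        using path_integral_is_primitive[OF pc P int lim0 lim1] by simp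
      show ?thesis
      proof (cases "k = \<alpha>")
        case True
        have "\<not> (k \<le> g \<or> j \<noteq> b k)" using 2 True by auto
        \<comment> \<open>Subtracting 1/(\<h> \<psi>^2) moves the base constant from L0 to L = L0 +
          1, the limit proper to this sector.\<close>
        moreover have "vfun V d \<h> \<psi> (h k) x - 1 / (\<h> * \<psi> x ^ 2) = (P x - L) / (\<h> * \<psi> x ^ 2)" for x
          unfolding v LL using True by (simp add: diff_divide_distrib add_divide_distrib)
        ultimately show ?thesis using big by simp
      next
        case False
        have "k \<le> g \<or> j \<noteq> b k" using False 2 D_indep k by (auto simp: inj_on_def)
        then show ?thesis using big LL False by (simp add: v[abs_def])
      qed
    qed
  qed
qed

end
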